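(* For any $x \in L^2(\mathbb{R}_+, \mu_r; \mathbb{R}^n)$, the problem of minimizing $$E(p,a) := \int_0^{+\infty} e^{-rt}\,\vert x(t) - p(t) - t a\vert^2\, dt$$ over all $p \in \overline{P_T^0}(\mathbb{R}_+,\mu_r;\mathbb{R}^n)$ and $a \in \mathbb{R}^n$ admits a unique solution $(\hat p, \hat a) \in \overline{P_T^0}(\mathbb{R}_+,\mu_r;\mathbb{R}^n)\times\mathbb{R}^n$. In addition, it is given by $$\hat a = \frac{r}{T}\int_0^T e^{-rs}\left(\tilde{\mathcal A}x(s) - \mathcal{A}x(s)\right) ds, \qquad \hat p = (\mathcal{E}_T\circ\mathcal{A})x - (\mathcal{E}_T\circ\mathcal{A})\underline{\hat a},$$ where $\underline{\hat a}(t) = \hat a\, t$ for $t\in\mathbb{R}_+$ and $$\tilde{\mathcal A}x(s) := \frac{(1-e^{-rT})^2}{e^{-rT}}\sum_{k=0}^{+\infty} k\,e^{-rkT}\,x(s+kT).$$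
   Context: Fix $n\in\mathbb{N}$ with $n \ge 1$, and real numbers $r>0$, $T>0$. $\mathbb{R}_+=[0,+\infty)$, $|\cdot|$ is the Euclidean norm on $\mathbb{R}^n$, and $\mu_r$ is the measure on $\mathbb{R}_+$ with density $t\mapsto e^{-rt}$ with respect to Lebesgue measure. $L^2(\mathbb{R}_+,\mu_r;\mathbb{R}^n)$ is the corresponding Hilbert space of (classes of) $\mathbb{R}^n$-valued functions, with inner product $(f\mid g)=\int_0^{+\infty}e^{-rt}f(t)\cdot g(t)\,dt$. $P_T^0(\mathbb{R}_+,\mathbb{R}^n)$ is the space of continuous $T$-periodic functions from $\mathbb{R}_+$ to $\mathbb{R}^n$, and $\overline{P_T^0}(\mathbb{R}_+,\mu_r;\mathbb{R}^n)$ is its closure in $L^2(\mathbb{R}_+,\mu_r;\mathbb{R}^n)$. Averaging operator: for $g:\mathbb{R}_+\to\mathbb{R}^n$, $\mathcal{A}g(s) := (1-e^{-rT})\sum_{k=0}^{+\infty}e^{-rkT}g(s+kT)$ for those $s\in[0,T]$ where the series is defined (this is the case for a.e. $s$ when $g\in L^2(\mathbb{R}_+,\mu_r;\mathbb{R}^n)$). Periodic extension: for $f:[0,T)\to\mathbb{R}^n$, $\mathcal{E}_T(f)(t) := f(t-kT)$ for $t\in[kT,(k+1)T)$, $k\in\mathbb{N}=\{0,1,2,\dots\}$. *)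

theory Defs
  imports "HOL-Analysis.Analysis"
begin

(* Functions on R_+ are represented by total functions on the reals; their values at negative
   arguments never matter.  Elements of the L2 space are represented by square-integrable
   functions, and equality of classes by equality almost everywhere. *)

definition mu :: "real \<Rightarrow> real measure" where
  "mu r = density (lebesgue_on {0..}) (\<lambda>t. ennreal (exp (- r * t)))"

definition L2 :: "real \<Rightarrow> (real \<Rightarrow> real ^ 'n) set" where
  "L2 r = {f. f \<in> borel_measurable (mu r) \<and> integrable (mu r) (\<lambda>t. (norm (f t))\<^sup>2)}"

definition L2_norm :: "real \<Rightarrow> (real \<Rightarrow> real ^ 'n) \<Rightarrow> real" where
  "L2_norm r f = sqrt (LINT t|mu r. (norm (f t))\<^sup>2)"

definition periodic_cont :: "real \<Rightarrow> (real \<Rightarrow> real ^ 'n) set" where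
  "periodic_cont T = {q. continuous_on {0..} q \<and> (\<forall>t\<ge>0. q (t + T) = q t)}"

definition periodic_closure :: "real \<Rightarrow> real \<Rightarrow> (real \<Rightarrow> real ^ 'n) set" where
  "periodic_closure r T =
     {f \<in> L2 r. \<forall>\<epsilon>>0. \<exists>q\<in>periodic_cont T. L2_norm r (\<lambda>t. f t - q t) < \<epsilon>}"

definition avg :: "real \<Rightarrow> real \<Rightarrow> (real \<Rightarrow> real ^ 'n) \<Rightarrow> real \<Rightarrow> real ^ 'n" where
  "avg r T g s =
     (1 - exp (- r * T)) *\<^sub>R (\<Sum>k. exp (- r * real k * T) *\<^sub>R g (s + real k * T))"

definition avg_tilde :: "real \<Rightarrow> real \<Rightarrow> (real \<Rightarrow> real ^ 'n) \<Rightarrow> real \<Rightarrow> real ^ 'n" where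
  "avg_tilde r T g s =
     ((1 - exp (- r * T))\<^sup>2 / exp (- r * T)) *\<^sub>R
       (\<Sum>k. (real k * exp (- r * real k * T)) *\<^sub>R g (s + real k * T))"

(* For t in [kT, (k+1)T) the floor of t / T is k. *)
definition periodic_ext :: "real \<Rightarrow> (real \<Rightarrow> real ^ 'n) \<Rightarrow> real \<Rightarrow> real ^ 'n" where
  "periodic_ext T f t = f (t - real_of_int \<lfloor>t / T\<rfloor> * T)"

definition energy ::
  "real \<Rightarrow> (real \<Rightarrow> real ^ 'n) \<Rightarrow> (real \<Rightarrow> real ^ 'n) \<Rightarrow> real ^ 'n \<Rightarrow> real" where
  "energy r x p a =
     (LINT t:{0..}|lebesgue. exp (- r * t) * (norm (x t - p t - t *\<^sub>R a))\<^sup>2)"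

definition is_solution ::
  "real \<Rightarrow> real \<Rightarrow> (real \<Rightarrow> real ^ 'n) \<Rightarrow> (real \<Rightarrow> real ^ 'n) \<Rightarrow> real ^ 'n \<Rightarrow> bool" where
  "is_solution r T x p a \<longleftrightarrow>
     p \<in> periodic_closure r T \<and>
     (\<forall>q\<in>periodic_closure r T. \<forall>b. energy r x p a \<le> energy r x q b)"

end

theory Submission
  imports Defs
begin

text \<open>
  Cutting \<open>[0, \<infinity>)\<close> into periods turns an integral against \<open>mu r\<close> into an integral over
  \<open>[0, T)\<close> of a geometrically weighted series. Hence \<open>P = periodic_ext T \<circ> avg r T\<close> is the
  orthogonal projection onto the periodic functions, and these form the closure of the continuous
  periodic ones. With \<open>q = exp (- r * T)\<close>, the part of \<open>t\<close> orthogonal to the periodic functions is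
  the step function \<open>drift r T t = t - P t = T * (\<lfloor>t / T\<rfloor> - q / (1 - q))\<close>. So \<open>a\<close> is the
  coefficient of the projection of \<open>x\<close> on \<open>drift r T\<close>, the residual
  \<open>x - P x - a * drift r T\<close> is orthogonal to all admissible variations, and the Pythagorean
  identity yields existence, uniqueness and the formulas at once.
\<close>

section \<open>Folding integrals over periods\<close>

text \<open>The weights \<open>exp (- r * real k * T)\<close> along a fibre s + kT do not depend on
  s: multiplied by 1 - q they form a geometric law with mean q / (1 - q) and variance q / (1 - q)^2.
  On a fibre, \<open>drift\<close> is T times the centred index, which explains its constant and the
  later ones: its squared norm is T^2 q / ((1 - q)^2 r), and the factor r / T in the formula for a
  is the quotient of T q / (1 - q)^2 by that norm. Two obstacles shape the argument. For a general x
  the series behind \<open>avg\<close> converge only for almost every s, so identities on fibres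
  hold almost everywhere and measurability is supplied separately. And members of
  \<open>periodic_closure\<close> are representatives that need not be literally periodic:
  orthogonality is shown against periodic functions and carried to the closure by Cauchy-Schwarz,
  while density is used in one direction, to place the explicit candidate p in the closure.\<close>

lemma integral_lebesgue_translation:
  fixes f :: "real \<Rightarrow> 'b::{banach, second_countable_topology}"
  assumes "f \<in> borel_measurable lebesgue"
  shows "integrable lebesgue (\<lambda>t. f (t + c)) \<longleftrightarrow> integrable lebesgue f"
    and "(LINT t|lebesgue. f (t + c)) = (LINT t|lebesgue. f t)"
proof -
  have m: "(\<lambda>t. t + c) \<in> lebesgue \<rightarrow>\<^sub>M lebesgue"
    using lebesgue_affine_measurable[where c= "\<lambda>x::real. 1" and t = c] by (simp add: add.commute)
  \<comment> \<open>The affine change of variables with slope 1 shows that the completed measure is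
    its own image under translation, so Lebesgue measurability of \<open>f\<close> suffices.\<close>
  have d: "lebesgue = distr lebesgue lebesgue (\<lambda>t. t + c)"
    using lebesgue_real_affine[of 1 c] by (simp add: density_1 add.commute)
  show "integrable lebesgue (\<lambda>t. f (t + c)) \<longleftrightarrow> integrable lebesgue f"
    using integrable_distr_eq[OF m assms] d by simp
  show "(LINT t|lebesgue. f (t + c)) = (LINT t|lebesgue. f t)"
    using integral_distr[OF m assms] d by simp
qed

lemma borel_measurable_lebesgue_translation:
  assumes "f \<in> borel_measurable lebesgue"
  shows "(\<lambda>t::real. f (t + c)) \<in> borel_measurable lebesgue"
proof -
  have m: "(\<lambda>t. t + c) \<in> lebesgue \<rightarrow>\<^sub>M lebesgue"
    using lebesgue_affine_measurable[where c= "\<lambda>x::real. 1" and t = c] by (simp add: add.commute)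
  show ?thesis using measurable_compose[OF m assms] by simp
qed

lemma nn_integral_lebesgue_translation:
  fixes f :: "real \<Rightarrow> ennreal"
  assumes "f \<in> borel_measurable lebesgue"
  shows "(\<integral>\<^sup>+t. f (t + c) \<partial>lebesgue) = (\<integral>\<^sup>+t. f t \<partial>lebesgue)"
  using nn_integral_real_affine_lebesgue[OF assms, of 1 c] by (simp add: add.commute)

text \<open>Half-open periods tile the half-line, so exactly one index is active at each t. Every
  series over periods at a fixed t thereby collapses to a single term.\<close>

lemma indicator_period:
  fixes t T :: real
  assumes "T > 0" "t \<ge> 0"
  shows "indicator {real k * T..<real k * T + T} t = (if k = nat \<lfloor>t / T\<rfloor> then 1 else (0::'a::zero_neq_one))"
proof -
  have "t \<in> {real k * T..<real k * T + T} \<longleftrightarrow> real k \<le> t / T \<and> t / T < real k + 1"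
    using assms by (auto simp: field_simps)
  also have "\<dots> \<longleftrightarrow> \<lfloor>t / T\<rfloor> = int k"
    by (auto simp: floor_eq_iff)
  also have "\<dots> \<longleftrightarrow> k = nat \<lfloor>t / T\<rfloor>" using assms by auto
  finally show ?thesis by (auto simp: indicator_def)
qed

text \<open>Tonelli for the tiling, followed by a translation of each tile to [0, T). The
  extended-valued form presupposes no convergence, so it can be used to establish
  convergence.\<close>

lemma nn_integral_fold:
  fixes f :: "real \<Rightarrow> ennreal"
  assumes T: "T > 0" and f: "f \<in> borel_measurable lebesgue" "\<And>t. t < 0 \<Longrightarrow> f t = 0"
  shows "(\<integral>\<^sup>+t. f t \<partial>lebesgue) =
    (\<integral>\<^sup>+s. (\<Sum>k. f (s + real k * T)) * indicator {0..<T} s \<partial>lebesgue)"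
proof -
  have m: "(\<lambda>t. f (t + c) * indicator {a..<b} (t + d)) \<in> borel_measurable lebesgue" for a b c d
    by (intro borel_measurable_times_ennreal borel_measurable_lebesgue_translation f(1)
        borel_measurable_lebesgue_translation[of "\<lambda>t. indicator {a..<b} t"] borel_measurable_indicator) auto
  note [measurable] = m[where c = 0 and d = 0, simplified] m[where d = 0, simplified]
  have eq: "f t = (\<Sum>k. f t * indicator {real k * T..<real k * T + T} t)" for t
  proof (cases "t < 0")
    case False
    define n where "n = nat \<lfloor>t / T\<rfloor>"
    have "(\<lambda>k. f t * indicator {real k * T..<real k * T + T} t) = (\<lambda>k. if k = n then f t else 0)"
      using False T by (auto simp: indicator_period n_def)
    then show ?thesis using sums_unique[OF sums_single[of n "\<lambda>_. f t"]] by simp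
  qed (simp add: f)
  have "(\<integral>\<^sup>+t. f t \<partial>lebesgue) =
    (\<Sum>k. \<integral>\<^sup>+t. f t * indicator {real k * T..<real k * T + T} t \<partial>lebesgue)"
    by (subst eq, subst nn_integral_suminf) auto
  also have "\<dots> = (\<Sum>k. \<integral>\<^sup>+s. f (s + real k * T) * indicator {0..<T} s \<partial>lebesgue)"
  proof (rule suminf_cong)
    fix k
    have "(\<integral>\<^sup>+t. f t * indicator {real k * T..<real k * T + T} t \<partial>lebesgue) =
      (\<integral>\<^sup>+s. f (s + real k * T) * indicator {real k * T..<real k * T + T} (s + real k * T) \<partial>lebesgue)"
      by (subst nn_integral_lebesgue_translation[symmetric, of _ "real k * T"]) auto
    also have "\<dots> = (\<integral>\<^sup>+s. f (s + real k * T) * indicator {0..<T} s \<partial>lebesgue)"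
      by (intro nn_integral_cong) (auto simp: indicator_def)
    finally show "(\<integral>\<^sup>+t. f t * indicator {real k * T..<real k * T + T} t \<partial>lebesgue) = \<dots>" .
  qed
  also have "\<dots> = (\<integral>\<^sup>+s. (\<Sum>k. f (s + real k * T) * indicator {0..<T} s) \<partial>lebesgue)"
    by (subst nn_integral_suminf) auto
  also have "\<dots> = (\<integral>\<^sup>+s. (\<Sum>k. f (s + real k * T)) * indicator {0..<T} s \<partial>lebesgue)"
    by simp
  finally show ?thesis .
qed

text \<open>The extended-valued folding of \<open>norm (f t)\<close> is finite, which gives absolute
  convergence on almost every fibre. Sum and integral are then interchanged twice: over the
  translated pieces \<open>F k\<close> on [0, T), and over the original pieces \<open>G k\<close>,
  which add up to \<open>f\<close>.\<close>

lemma integral_fold: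
  fixes f :: "real \<Rightarrow> 'b::{banach, second_countable_topology}"
  assumes T: "T > 0" and f: "integrable lebesgue f" "\<forall>t<0. f t = 0"
  shows "AE s in lebesgue. s \<in> {0..<T} \<longrightarrow> summable (\<lambda>k. norm (f (s + real k * T)))"
    and "set_integrable lebesgue {0..<T} (\<lambda>s. \<Sum>k. f (s + real k * T))"
    and "(LINT t|lebesgue. f t) = (LINT s:{0..<T}|lebesgue. \<Sum>k. f (s + real k * T))"
proof -
  have fm[measurable]: "f \<in> borel_measurable lebesgue" using f(1) by auto
  note [measurable] = borel_measurable_lebesgue_translation[OF fm]
  define F where "F = (\<lambda>k s. indicator {0..<T} s *\<^sub>R f (s + real k * T))"
  define G where "G = (\<lambda>k t. indicator {real k * T..<real k * T + T} t *\<^sub>R f t)"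
  have Fm[measurable]: "F k \<in> borel_measurable lebesgue" for k
    unfolding F_def
    by (intro borel_measurable_scaleR borel_measurable_indicator borel_measurable_lebesgue_translation[OF fm]) auto
  have Gm[measurable]: "G k \<in> borel_measurable lebesgue" for k
    unfolding G_def by (intro borel_measurable_scaleR borel_measurable_indicator fm) auto
  have FG: "F k = (\<lambda>s. G k (s + real k * T))" for k
    by (auto simp: F_def G_def indicator_def)
  have Gi: "integrable lebesgue (G k)" for k
    unfolding G_def by (intro integrable_mult_indicator f(1)) auto
  then have Fi: "integrable lebesgue (F k)" for k
    unfolding FG by (subst integral_lebesgue_translation) auto
  have FGint: "(LINT s|lebesgue. F k s) = (LINT t|lebesgue. G k t)" for k
    unfolding FG by (subst integral_lebesgue_translation) auto
  have FGn: "(LINT s|lebesgue. norm (F k s)) = (LINT t|lebesgue. norm (G k t))" for k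
    unfolding FG by (subst integral_lebesgue_translation(2)[of "\<lambda>s. norm (G k s)"]) auto
  have Gs: "(\<lambda>k. G k t) sums f t" for t
  proof (cases "t < 0")
    case False
    define n where "n = nat \<lfloor>t / T\<rfloor>"
    have "(\<lambda>k. G k t) = (\<lambda>k. if k = n then f t else 0)"
      using False T by (auto simp: indicator_period n_def G_def)
    then show ?thesis using sums_single[of n "\<lambda>_. f t"] by simp
  qed (simp add: f G_def)
  have Gns: "(\<lambda>k. norm (G k t)) sums norm (f t)" for t
  proof (cases "t < 0")
    case False
    define n where "n = nat \<lfloor>t / T\<rfloor>"
    have "(\<lambda>k. norm (G k t)) = (\<lambda>k. if k = n then norm (f t) else 0)"
      using False T by (auto simp: indicator_period n_def G_def)
    then show ?thesis using sums_single[of n "\<lambda>_. norm (f t)"] by simp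
  qed (simp add: f G_def)
  \<comment> \<open>The pieces \<open>G k\<close> have disjoint supports, so their norms add up to
    \<open>norm (f t)\<close> and one integral bounds all partial sums.\<close>
  have sn: "summable (\<lambda>k. LINT t|lebesgue. norm (G k t))"
  proof (rule bounded_imp_summable)
    fix n
    have "(\<Sum>k\<le>n. LINT t|lebesgue. norm (G k t)) = (LINT t|lebesgue. (\<Sum>k\<le>n. norm (G k t)))"
      using Gi by (subst Bochner_Integration.integral_sum) auto
    also have "\<dots> \<le> (LINT t|lebesgue. norm (f t))"
    proof (intro integral_mono)
      show "integrable lebesgue (\<lambda>t. \<Sum>k\<le>n. norm (G k t))" using Gi by auto
      show "integrable lebesgue (\<lambda>t. norm (f t))" using f(1) by auto
      show "(\<Sum>k\<le>n. norm (G k t)) \<le> norm (f t)" for t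
        using sum_le_suminf[OF sums_summable[OF Gns], of "{..n}" t] sums_unique[OF Gns, of t] by auto
    qed
    finally show "(\<Sum>k\<le>n. LINT t|lebesgue. norm (G k t)) \<le> (LINT t|lebesgue. norm (f t))" .
  qed auto
  have "(\<integral>\<^sup>+s. (\<Sum>k. ennreal (norm (f (s + real k * T)))) * indicator {0..<T} s \<partial>lebesgue) = (\<integral>\<^sup>+t. ennreal (norm (f t)) \<partial>lebesgue)"
    using T f by (subst nn_integral_fold[of T "\<lambda>t. ennreal (norm (f t))"]) auto
  also have "\<dots> < \<infinity>" using f(1) by (simp add: integrable_iff_bounded)
  finally have "AE s in lebesgue. (\<Sum>k. ennreal (norm (f (s + real k * T)))) * indicator {0..<T} s \<noteq> \<infinity>"
    by (intro nn_integral_PInf_AE borel_measurable_times_ennreal borel_measurable_suminf_order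
        borel_measurable_indicator) auto
  then show ae: "AE s in lebesgue. s \<in> {0..<T} \<longrightarrow> summable (\<lambda>k. norm (f (s + real k * T)))"
    by eventually_elim (auto intro: summable_suminf_not_top)
  have aeF: "AE s in lebesgue. summable (\<lambda>k. norm (F k s))"
    using ae by eventually_elim (auto simp: F_def indicator_def)
  have sF: "summable (\<lambda>k. LINT s|lebesgue. norm (F k s))" using sn FGn by simp
  have Fsum: "(\<Sum>k. F k s) = indicator {0..<T} s *\<^sub>R (\<Sum>k. f (s + real k * T))" for s
    by (auto simp: F_def indicator_def)
  show "set_integrable lebesgue {0..<T} (\<lambda>s. \<Sum>k. f (s + real k * T))"
    unfolding set_integrable_def Fsum[symmetric] by (rule integrable_suminf[OF Fi aeF sF])
  have "(LINT s:{0..<T}|lebesgue. \<Sum>k. f (s + real k * T)) = (LINT s|lebesgue. (\<Sum>k. F k s))"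
    unfolding set_lebesgue_integral_def Fsum ..
  also have "\<dots> = (\<Sum>k. LINT s|lebesgue. F k s)"
    by (rule integral_suminf[OF Fi aeF sF])
  also have "\<dots> = (\<Sum>k. LINT s|lebesgue. G k s)" using FGint by simp
  also have "\<dots> = (LINT t|lebesgue. (\<Sum>k. G k t))"
    by (rule integral_suminf[symmetric, OF Gi _ sn]) (auto intro: sums_summable[OF Gns])
  also have "\<dots> = (LINT t|lebesgue. f t)" using sums_unique[OF Gs] by simp
  finally show "(LINT t|lebesgue. f t) = (LINT s:{0..<T}|lebesgue. \<Sum>k. f (s + real k * T))" ..
qed

section \<open>Passage between \<open>mu r\<close> and Lebesgue measure\<close>

lemma borel_measurable_mu_iff:
  fixes f :: "real \<Rightarrow> 'b::real_normed_vector"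
  shows "f \<in> borel_measurable (mu r) \<longleftrightarrow> (\<lambda>t. indicator {0..} t *\<^sub>R f t) \<in> borel_measurable lebesgue"
proof -
  have "f \<in> borel_measurable (mu r) \<longleftrightarrow> f \<in> borel_measurable (lebesgue_on {0..})"
    unfolding mu_def by simp
  then show ?thesis by (subst (asm) borel_measurable_restrict_space_iff) auto
qed

lemma exp_weight_measurable: "(\<lambda>t. exp (- r * t)) \<in> borel_measurable (lebesgue_on {0::real..})"
  by (intro continuous_imp_measurable_on_sets_lebesgue continuous_intros) auto

lemma ennreal_exp_weight_measurable:
  "(\<lambda>t. ennreal (exp (- r * t))) \<in> borel_measurable (lebesgue_on {0::real..})"
  by (rule measurable_compose[OF exp_weight_measurable measurable_ennreal])

lemma AE_mu_iff: "(AE t in mu r. P t) \<longleftrightarrow> (AE t in lebesgue. t \<ge> 0 \<longrightarrow> P t)"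
proof -
  have "(AE t in mu r. P t) \<longleftrightarrow> (AE t in lebesgue_on {0..}. P t)"
    unfolding mu_def AE_density[OF ennreal_exp_weight_measurable] by simp
  also have "\<dots> \<longleftrightarrow> (AE t in lebesgue. t \<ge> 0 \<longrightarrow> P t)"
    by (subst AE_restrict_space_iff) auto
  finally show ?thesis .
qed

lemma integrable_mu_iff:
  fixes f :: "real \<Rightarrow> 'b::{banach, second_countable_topology}"
  assumes f: "f \<in> borel_measurable (mu r)"
  shows "integrable (mu r) f \<longleftrightarrow> integrable lebesgue (\<lambda>t. indicator {0..} t *\<^sub>R (exp (- r * t) *\<^sub>R f t))"
  using assms exp_weight_measurable[of r] unfolding mu_def
  by (subst integrable_density) (simp_all add: integrable_restrict_space)

lemma integral_mu_eq:
  fixes f :: "real \<Rightarrow> 'b::{banach, second_countable_topology}"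
  assumes f: "f \<in> borel_measurable (mu r)"
  shows "integral\<^sup>L (mu r) f = (LINT t|lebesgue. indicator {0..} t *\<^sub>R (exp (- r * t) *\<^sub>R f t))"
  using assms exp_weight_measurable[of r] unfolding mu_def
  by (subst integral_density) (simp_all add: integral_restrict_space)

lemma nn_integral_mu_eq:
  assumes f: "f \<in> borel_measurable (mu r)"
  shows "integral\<^sup>N (mu r) f = (\<integral>\<^sup>+t. ennreal (exp (- r * t)) * f t * indicator {0..} t \<partial>lebesgue)"
proof -
  show ?thesis using assms unfolding mu_def
    by (subst nn_integral_density[OF ennreal_exp_weight_measurable]) (simp_all add: nn_integral_restrict_space)
qed

lemma measurable_mu_continuous_on:
  assumes "continuous_on {0..} f"
  shows "f \<in> borel_measurable (mu r)"
  unfolding mu_def using continuous_imp_measurable_on_sets_lebesgue[OF assms] by simp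

lemma measurable_mu_borel:
  assumes "f \<in> borel_measurable borel"
  shows "f \<in> borel_measurable (mu r)"
proof -
  have "f \<in> borel_measurable lebesgue" using assms by (simp add: measurable_completion)
  then show ?thesis unfolding mu_def by (simp add: measurable_restrict_space1)
qed

text \<open>This factorisation is the reason why folding leaves a geometric weight on every fibre,
  with the dependence on s confined to one factor.\<close>

lemma exp_shift_period: "exp (- r * (s + real k * T)) = exp (- r * s) * exp (- r * real k * T)"
  by (simp add: exp_add[symmetric] distrib_left)

text \<open>Measurability of the folded series, including the points where it diverges and
  \<open>suminf\<close> takes a default value. For s in [0, T) all arguments are nonnegative, so
  \<open>f\<close> may be replaced by its cut to the half-line, which is measurable on the whole
  line.\<close>

lemma measurable_fold:
  fixes f :: "real \<Rightarrow> 'b::{banach, second_countable_topology}"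
  assumes T: "T > 0" and f: "f \<in> borel_measurable (mu r)"
  shows "(\<lambda>s. indicator {0..<T} s *\<^sub>R (\<Sum>k. c k *\<^sub>R f (s + real k * T))) \<in> borel_measurable lebesgue"
proof -
  define g where "g = (\<lambda>t. indicator {0..} t *\<^sub>R f t)"
  have g: "g \<in> borel_measurable lebesgue"
    using f unfolding borel_measurable_mu_iff g_def .
  have "(\<lambda>s. indicator {0..<T} s *\<^sub>R (\<Sum>k. c k *\<^sub>R f (s + real k * T))) =
    (\<lambda>s. indicator {0..<T} s *\<^sub>R (\<Sum>k. c k *\<^sub>R g (s + real k * T)))"
    using T by (intro ext) (auto simp: indicator_def g_def)
  also have "\<dots> \<in> borel_measurable lebesgue"
    by (intro borel_measurable_scaleR borel_measurable_indicator borel_measurable_suminf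
        borel_measurable_lebesgue_translation[OF g] borel_measurable_const) auto
  finally show ?thesis .
qed

lemma exp_power: "exp (- r * real k * T) = exp (- r * T) ^ k"
  using exp_of_nat_mult[of k "- r * T"] by (simp add: mult_ac)

section \<open>Folding against the exponential weight\<close>

context
  fixes r T :: real
  assumes r: "r > 0" and T: "T > 0"
begin

lemma mu_fold:
  fixes f :: "real \<Rightarrow> 'b::{banach, second_countable_topology}"
  assumes f: "integrable (mu r) f"
  shows "AE s in lebesgue. s \<in> {0..<T} \<longrightarrow> summable (\<lambda>k. exp (- r * real k * T) * norm (f (s + real k * T)))"
    and "set_integrable lebesgue {0..<T} (\<lambda>s. exp (- r * s) *\<^sub>R (\<Sum>k. exp (- r * real k * T) *\<^sub>R f (s + real k * T)))"
    and "integral\<^sup>L (mu r) f =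
      (LINT s:{0..<T}|lebesgue. exp (- r * s) *\<^sub>R (\<Sum>k. exp (- r * real k * T) *\<^sub>R f (s + real k * T)))"
proof -
  define g where "g = (\<lambda>t. indicator {0..} t *\<^sub>R (exp (- r * t) *\<^sub>R f t))"
  have fm: "f \<in> borel_measurable (mu r)" using f by auto
  have gi: "integrable lebesgue g" using f integrable_mu_iff[OF fm] by (simp add: g_def)
  have g0: "\<forall>t<0. g t = 0" by (simp add: g_def)
  note fold = integral_fold[OF T gi g0]
  have g_shift: "g (s + real k * T) = exp (- r * s) *\<^sub>R (exp (- r * real k * T) *\<^sub>R f (s + real k * T))"
    if "s \<in> {0..<T}" for s k
    using that T unfolding g_def by (auto simp: exp_shift_period[simplified])
  show ae: "AE s in lebesgue. s \<in> {0..<T} \<longrightarrow> summable (\<lambda>k. exp (- r * real k * T) * norm (f (s + real k * T)))"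
    using fold(1)
  proof eventually_elim
    case (elim s)
    show ?case
    proof
      assume s: "s \<in> {0..<T}"
      then have "summable (\<lambda>k. exp (- r * s) * (exp (- r * real k * T) * norm (f (s + real k * T))))"
        using elim by (simp add: g_shift mult.assoc)
      then show "summable (\<lambda>k. exp (- r * real k * T) * norm (f (s + real k * T)))"
        by (subst (asm) summable_cmult_iff) simp
    qed
  qed
  \<comment> \<open>Pulling \<open>exp (- r * s)\<close> out of the series relies on its
    convergence, so the two integrands are compared almost everywhere.\<close>
  have ae2: "AE s in lebesgue. indicator {0..<T} s *\<^sub>R (\<Sum>k. g (s + real k * T)) =
    indicator {0..<T} s *\<^sub>R (exp (- r * s) *\<^sub>R (\<Sum>k. exp (- r * real k * T) *\<^sub>R f (s + real k * T)))"
    using ae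
  proof eventually_elim
    case (elim s)
    show ?case
    proof (cases "s \<in> {0..<T}")
      case True
      have "summable (\<lambda>k. exp (- r * real k * T) *\<^sub>R f (s + real k * T))"
        using elim True by - (rule summable_norm_cancel, simp)
      then show ?thesis using True by (simp add: g_shift suminf_scaleR_right)
    qed auto
  qed
  have m1: "(\<lambda>s. indicator {0..<T} s *\<^sub>R (\<Sum>k. g (s + real k * T))) \<in> borel_measurable lebesgue"
    using fold(2) by (auto simp: set_integrable_def)
  have m2: "(\<lambda>s. indicator {0..<T} s *\<^sub>R (exp (- r * s) *\<^sub>R (\<Sum>k. exp (- r * real k * T) *\<^sub>R f (s + real k * T))))
    \<in> borel_measurable lebesgue"
  proof -
    have "(\<lambda>s. exp (- r * s) *\<^sub>R (indicator {0..<T} s *\<^sub>R (\<Sum>k. exp (- r * real k * T) *\<^sub>R f (s + real k * T))))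
    \<in> borel_measurable lebesgue"
      by (intro borel_measurable_scaleR measurable_fold[OF T fm]) (simp add: measurable_completion)
    then show ?thesis by (simp add: mult.commute)
  qed
  show "set_integrable lebesgue {0..<T} (\<lambda>s. exp (- r * s) *\<^sub>R (\<Sum>k. exp (- r * real k * T) *\<^sub>R f (s + real k * T)))"
    using fold(2) unfolding set_integrable_def integrable_cong_AE[OF m1 m2 ae2] .
  show "integral\<^sup>L (mu r) f =
      (LINT s:{0..<T}|lebesgue. exp (- r * s) *\<^sub>R (\<Sum>k. exp (- r * real k * T) *\<^sub>R f (s + real k * T)))"
    unfolding set_lebesgue_integral_def integral_cong_AE[OF m1 m2 ae2, symmetric] integral_mu_eq[OF fm] g_def[symmetric]
    using fold(3) unfolding set_lebesgue_integral_def .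
qed

lemma q_bounds: "0 < exp (- r * T)" "exp (- r * T) < 1"
  using r T by auto

lemma sums_q: "(\<lambda>k. exp (- r * real k * T)) sums (1 / (1 - exp (- r * T)))"
  unfolding exp_power using q_bounds by (intro geometric_sums) auto

text \<open>For a periodic function the folded series is the constant 1 / (1 - q) times the
  integrand on one period. The computation runs with extended integrals because
  \<open>mu_fold\<close> presupposes the integrability to be shown.\<close>

lemma integrable_mu_periodic:
  fixes f :: "real \<Rightarrow> real"
  assumes fm: "f \<in> borel_measurable (mu r)" and nn: "\<And>t. f t \<ge> 0"
    and per: "\<And>s k. s \<in> {0..<T} \<Longrightarrow> f (s + real k * T) = f s"
    and int: "set_integrable lebesgue {0..<T} (\<lambda>s. exp (- r * s) * f s)"
  shows "integrable (mu r) f"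
proof (rule integrableI_nonneg)
  show "f \<in> borel_measurable (mu r)" by fact
  show "AE t in mu r. 0 \<le> f t" using nn by simp
  define g where "g = (\<lambda>t. indicator {0..} t *\<^sub>R (exp (- r * t) *\<^sub>R f t))"
  have gm: "g \<in> borel_measurable lebesgue"
  proof -
    have "(\<lambda>t. exp (- r * t) *\<^sub>R (indicator {0..} t *\<^sub>R f t)) \<in> borel_measurable lebesgue"
      using fm unfolding borel_measurable_mu_iff
      by (rule borel_measurable_scaleR[rotated]) (simp add: measurable_completion)
    then show ?thesis by (simp add: g_def mult_ac)
  qed
  have g_shift: "g (s + real k * T) = exp (- r * real k * T) * (exp (- r * s) * f s)"
    if "s \<in> {0..<T}" for s k
    using that T unfolding g_def by (auto simp: exp_shift_period[simplified] per)
  have sum: "(\<Sum>k. ennreal (g (s + real k * T))) = ennreal (1 / (1 - exp (- r * T)) * (exp (- r * s) * f s))"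
    if "s \<in> {0..<T}" for s
  proof -
    have "(\<lambda>k. g (s + real k * T)) sums (1 / (1 - exp (- r * T)) * (exp (- r * s) * f s))"
      unfolding g_shift[OF that] by (intro sums_mult2 sums_q)
    then show ?thesis
      by (intro suminf_ennreal_eq) (auto simp: g_def nn)
  qed
  have "(\<integral>\<^sup>+t. ennreal (f t) \<partial>mu r) = (\<integral>\<^sup>+t. ennreal (g t) \<partial>lebesgue)"
    using fm by (subst nn_integral_mu_eq)
      (auto simp: g_def indicator_def ennreal_mult nn intro!: nn_integral_cong)
  also have "\<dots> = (\<integral>\<^sup>+s. (\<Sum>k. ennreal (g (s + real k * T))) * indicator {0..<T} s \<partial>lebesgue)"
    using gm T by (intro nn_integral_fold) (auto simp: g_def)
  also have "\<dots> = (\<integral>\<^sup>+s. ennreal (norm (1 / (1 - exp (- r * T)) * (indicator {0..<T} s *\<^sub>R (exp (- r * s) * f s)))) \<partial>lebesgue)"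
  proof (intro nn_integral_cong)
    fix s
    have "0 \<le> 1 / (1 - exp (- r * T)) * (exp (- r * s) * f s)"
      using q_bounds nn by (intro mult_nonneg_nonneg) auto
    then show "(\<Sum>k. ennreal (g (s + real k * T))) * indicator {0..<T} s =
      ennreal (norm (1 / (1 - exp (- r * T)) * (indicator {0..<T} s *\<^sub>R (exp (- r * s) * f s))))"
      using sum[of s] by (cases "s \<in> {0..<T}") (simp_all only: indicator_simps, simp_all add: nn abs_mult abs_of_pos r T)
  qed
  also have "\<dots> < \<infinity>"
    using int unfolding set_integrable_def
    by (subst integrable_iff_bounded[THEN iffD1, THEN conjunct2]) auto
  finally show "(\<integral>\<^sup>+t. ennreal (f t) \<partial>mu r) < \<infinity>" .
qed

end

section \<open>Square-integrable functions\<close>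

lemma L2_D:
  assumes "f \<in> L2 r"
  shows "f \<in> borel_measurable (mu r)" "integrable (mu r) (\<lambda>t. (norm (f t))\<^sup>2)"
  using assms by (auto simp: L2_def)

lemma integrable_mu_mult_of_squares:
  fixes f g :: "real \<Rightarrow> real"
  assumes [measurable]: "f \<in> borel_measurable (mu r)" "g \<in> borel_measurable (mu r)"
    and i: "integrable (mu r) (\<lambda>t. (f t)\<^sup>2)" "integrable (mu r) (\<lambda>t. (g t)\<^sup>2)"
  shows "integrable (mu r) (\<lambda>t. f t * g t)"
proof (rule Bochner_Integration.integrable_bound)
  show "integrable (mu r) (\<lambda>t. (f t)\<^sup>2 + (g t)\<^sup>2)" using i by simp
  have "\<bar>a * b\<bar> \<le> a\<^sup>2 + b\<^sup>2" for a b :: real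
  proof -
    have "2 * \<bar>a\<bar> * \<bar>b\<bar> \<le> a\<^sup>2 + b\<^sup>2" using sum_squares_bound[of "\<bar>a\<bar>" "\<bar>b\<bar>"] by simp
    moreover have "0 \<le> \<bar>a\<bar> * \<bar>b\<bar>" by simp
    ultimately have "\<bar>a\<bar> * \<bar>b\<bar> \<le> a\<^sup>2 + b\<^sup>2" by linarith
    then show ?thesis by (simp add: abs_mult)
  qed
  then show "AE t in mu r. norm (f t * g t) \<le> norm ((f t)\<^sup>2 + (g t)\<^sup>2)" by simp
qed measurable

lemma L2_inner_integrable:
  assumes "f \<in> L2 r" "g \<in> L2 r"
  shows "integrable (mu r) (\<lambda>t. f t \<bullet> g t)"
proof (rule Bochner_Integration.integrable_bound)
  note [measurable] = L2_D(1)[OF assms(1)] L2_D(1)[OF assms(2)]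
  show "integrable (mu r) (\<lambda>t. norm (f t) * norm (g t))"
    using L2_D(2)[OF assms(1)] L2_D(2)[OF assms(2)] by (intro integrable_mu_mult_of_squares) auto
  show "AE t in mu r. norm (f t \<bullet> g t) \<le> norm (norm (f t) * norm (g t))"
    by (simp add: Cauchy_Schwarz_ineq2)
  show "(\<lambda>t. f t \<bullet> g t) \<in> borel_measurable (mu r)" by measurable
qed

lemma norm_add_squared: "(norm (x + y))\<^sup>2 = (norm x)\<^sup>2 + 2 * (x \<bullet> y) + (norm (y::'a::real_inner))\<^sup>2"
  by (simp add: power2_norm_eq_inner inner_add inner_commute)

lemma L2_add:
  assumes "f \<in> L2 r" "g \<in> L2 r"
  shows "(\<lambda>t. f t + g t) \<in> L2 r"
    and "(LINT t|mu r. (norm (f t + g t))\<^sup>2) =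
      (LINT t|mu r. (norm (f t))\<^sup>2) + 2 * (LINT t|mu r. f t \<bullet> g t) + (LINT t|mu r. (norm (g t))\<^sup>2)"
proof -
  note [measurable] = L2_D(1)[OF assms(1)] L2_D(1)[OF assms(2)]
  note [simp] = L2_D(2)[OF assms(1)] L2_D(2)[OF assms(2)] L2_inner_integrable[OF assms]
  show "(\<lambda>t. f t + g t) \<in> L2 r" unfolding L2_def by (simp add: norm_add_squared)
  show "(LINT t|mu r. (norm (f t + g t))\<^sup>2) =
      (LINT t|mu r. (norm (f t))\<^sup>2) + 2 * (LINT t|mu r. f t \<bullet> g t) + (LINT t|mu r. (norm (g t))\<^sup>2)"
    unfolding norm_add_squared by simp
qed

lemma L2_scaleR:
  assumes "f \<in> L2 r"
  shows "(\<lambda>t. c *\<^sub>R f t) \<in> L2 r"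
  using L2_D[OF assms] by (simp add: L2_def power_mult_distrib)

lemma L2_diff:
  assumes "f \<in> L2 r" "g \<in> L2 r"
  shows "(\<lambda>t. f t - g t) \<in> L2 r"
  using L2_add(1)[OF assms(1) L2_scaleR[OF assms(2), of "-1"]] by simp

lemma L2_scaleR_const:
  assumes "f \<in> borel_measurable (mu r)" "integrable (mu r) (\<lambda>t. (f t)\<^sup>2)"
  shows "(\<lambda>t. f t *\<^sub>R a) \<in> L2 r"
  using assms by (simp add: L2_def power_mult_distrib)

lemma L2_scaleR_integrable:
  assumes "f \<in> borel_measurable (mu r)" "integrable (mu r) (\<lambda>t. (f t)\<^sup>2)" and g: "g \<in> L2 r"
  shows "integrable (mu r) (\<lambda>t. f t *\<^sub>R g t)"
proof (rule Bochner_Integration.integrable_bound)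
  note [measurable] = assms(1) L2_D(1)[OF g]
  show "integrable (mu r) (\<lambda>t. f t * norm (g t))"
    using assms L2_D(2)[OF g] by (intro integrable_mu_mult_of_squares) auto
  show "AE t in mu r. norm (f t *\<^sub>R g t) \<le> norm (f t * norm (g t))"
    by (simp add: abs_mult)
  show "(\<lambda>t. f t *\<^sub>R g t) \<in> borel_measurable (mu r)" by measurable
qed

text \<open>\<open>L2 r\<close> is a set of representatives and not an inner product type, so the
  inequality is derived from the quadratic c \<mapsto> A + 2 c C + c^2 B, which is the squared norm
  of f + c g and hence nonnegative.\<close>

lemma L2_Cauchy_Schwarz:
  assumes "f \<in> L2 r" "g \<in> L2 r"
  shows "\<bar>LINT t|mu r. f t \<bullet> g t\<bar> \<le> L2_norm r f * L2_norm r g"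
proof -
  define A B C where "A = (LINT t|mu r. (norm (f t))\<^sup>2)" and "B = (LINT t|mu r. (norm (g t))\<^sup>2)"
    and "C = (LINT t|mu r. f t \<bullet> g t)"
  have quad: "0 \<le> A + 2 * c * C + c\<^sup>2 * B" for c
  proof -
    have "0 \<le> (LINT t|mu r. (norm (f t + c *\<^sub>R g t))\<^sup>2)" by simp
    also have "\<dots> = A + 2 * c * C + c\<^sup>2 * B"
      unfolding L2_add(2)[OF assms(1) L2_scaleR[OF assms(2)]]
      by (simp add: A_def B_def C_def power_mult_distrib)
    finally show ?thesis .
  qed
  have B0: "B \<ge> 0" and A0: "A \<ge> 0" by (simp_all add: A_def B_def)
  have "C\<^sup>2 \<le> A * B"
  proof (cases "B = 0")
    case True
    \<comment> \<open>With B = 0 the quadratic is affine in c; at c = - (A + 1) / C it would take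
      the negative value - A - 2.\<close>
    have "C = 0"
    proof (rule ccontr)
      assume "C \<noteq> 0"
      then have "2 * (- (A + 1) / C) * C = - 2 * (A + 1)" by simp
      then show False using quad[of "- (A + 1) / C"] True A0 by simp
    qed
    then show ?thesis using True by simp
  next
    case False
    \<comment> \<open>The point - C / B is the minimiser, where the quadratic equals A - C^2 /
      B.\<close>
    then show ?thesis using quad[of "- C / B"] B0 by (simp add: field_simps power2_eq_square)
  qed
  then have "sqrt (C\<^sup>2) \<le> sqrt (A * B)" by (rule real_sqrt_le_mono)
  then show ?thesis
    by (simp add: A_def B_def C_def L2_norm_def real_sqrt_mult)
qed

text \<open>First and second moments of the geometric law before normalisation. Both series
  telescope against a polynomial times q^k, which yields convergence and value together.\<close>

lemma sums_k_power:
  fixes q :: real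
  assumes "0 < q" "q < 1"
  shows "(\<lambda>k. real k * q ^ k) sums (q / (1 - q)\<^sup>2)"
    and "(\<lambda>k. (real k)\<^sup>2 * q ^ k) sums (q * (1 + q) / (1 - q) ^ 3)"
proof -
  have lim0: "(\<lambda>k. q ^ k) \<longlonglongrightarrow> 0" using assms by (intro LIMSEQ_power_zero) auto
  have lim1: "(\<lambda>k. real k * q ^ k) \<longlonglongrightarrow> 0" using assms by (intro powser_times_n_limit_0) auto
  \<comment> \<open>Since k^2 q^k is the square of k (sqrt q)^k, the quadratic factor reduces to the
    linear limit.\<close>
  have "(\<lambda>k. (real k * sqrt q ^ k)\<^sup>2) \<longlonglongrightarrow> 0\<^sup>2"
    using assms by (intro tendsto_power powser_times_n_limit_0) (auto simp: real_sqrt_lt_1_iff)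
  moreover have "(real k * sqrt q ^ k)\<^sup>2 = (real k)\<^sup>2 * q ^ k" for k
  proof -
    have "(sqrt q ^ k)\<^sup>2 = (sqrt q * sqrt q) ^ k" by (simp only: power2_eq_square power_mult_distrib)
    then show ?thesis using assms by (simp add: power_mult_distrib)
  qed
  ultimately have lim2: "(\<lambda>k. (real k)\<^sup>2 * q ^ k) \<longlonglongrightarrow> 0" by simp
  \<comment> \<open>With f k = (a k^2 + b k + c) q^k, matching coefficients in f k - f (k + 1) = k^2
    q^k gives the relations for a, b and c below. In the same way f k = (a k + d) q^k serves k q^k.
    The sum is f 0 in either case, that is c or d.\<close>
  define a b c d where "a = 1 / (1 - q)" and "b = 2 * a * q / (1 - q)" and "c = q * (a + b) / (1 - q)"
    and "d = a * q / (1 - q)"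
  have a: "a * (1 - q) = 1" and b: "b * (1 - q) = 2 * a * q" and c: "c * (1 - q) = q * (a + b)"
    and d: "d * (1 - q) = a * q"
    using assms by (simp_all add: a_def b_def c_def d_def)
  have "(\<lambda>k. (a * (real k * q ^ k) + d * q ^ k)) \<longlonglongrightarrow> a * 0 + d * 0"
    by (intro tendsto_intros lim0 lim1)
  from telescope_sums'[OF this]
  have s: "(\<lambda>k. (a * (real k * q ^ k) + d * q ^ k) - (a * (real (Suc k) * q ^ Suc k) + d * q ^ Suc k)) sums d"
    by simp
  have "(a * (real k * q ^ k) + d * q ^ k) - (a * (real (Suc k) * q ^ Suc k) + d * q ^ Suc k) =
    q ^ k * (real k * (a * (1 - q)) + (d * (1 - q) - a * q))" for k
    by (simp add: algebra_simps)
  with s have "(\<lambda>k. real k * q ^ k) sums d" unfolding a d by (simp add: mult.commute)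
  moreover have "d = q / (1 - q)\<^sup>2" by (simp add: d_def a_def power2_eq_square)
  ultimately show "(\<lambda>k. real k * q ^ k) sums (q / (1 - q)\<^sup>2)" by simp
  have "(\<lambda>k. (a * ((real k)\<^sup>2 * q ^ k) + b * (real k * q ^ k) + c * q ^ k)) \<longlonglongrightarrow> a * 0 + b * 0 + c * 0"
    by (intro tendsto_intros lim0 lim1 lim2)
  from telescope_sums'[OF this]
  have s: "(\<lambda>k. (a * ((real k)\<^sup>2 * q ^ k) + b * (real k * q ^ k) + c * q ^ k) -
    (a * ((real (Suc k))\<^sup>2 * q ^ Suc k) + b * (real (Suc k) * q ^ Suc k) + c * q ^ Suc k)) sums c"
    by simp
  have "(a * ((real k)\<^sup>2 * q ^ k) + b * (real k * q ^ k) + c * q ^ k) -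
    (a * ((real (Suc k))\<^sup>2 * q ^ Suc k) + b * (real (Suc k) * q ^ Suc k) + c * q ^ Suc k) =
    q ^ k * ((real k)\<^sup>2 * (a * (1 - q)) + real k * (b * (1 - q) - 2 * a * q) + (c * (1 - q) - q * (a + b)))" for k
    by (simp add: algebra_simps power2_eq_square)
  with s have "(\<lambda>k. (real k)\<^sup>2 * q ^ k) sums c" unfolding a b c by (simp add: mult.commute)
  moreover have "c = q * (1 + q) / (1 - q) ^ 3"
  proof -
    have "q * (1 / p + 2 * (1 / p) * q / p) / p = q * (p + 2 * q) / p ^ 3" if "p \<noteq> 0" for p
      using that by (simp add: field_simps power3_eq_cube)
    from this[of "1 - q"] show ?thesis using assms by (simp add: c_def b_def a_def)
  qed
  ultimately show "(\<lambda>k. (real k)\<^sup>2 * q ^ k) sums (q * (1 + q) / (1 - q) ^ 3)" by simp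
qed

section \<open>Finiteness of \<open>mu r\<close> and square-integrability of time\<close>

lemma set_integrable_exp:
  fixes r :: real
  assumes r: "r > 0"
  shows "set_integrable lebesgue {0..} (\<lambda>t. exp (- r * t))"
proof -
  have "(\<lambda>t. exp (- r * t)) integrable_on {0..}"
    using has_integral_exp_minus_to_infinity[OF r, of 0] by (auto simp: integrable_on_def)
  then show ?thesis
    by (intro nonnegative_absolutely_integrable_1) auto
qed

lemma integrable_mu_const:
  assumes "r > 0"
  shows "integrable (mu r) (\<lambda>_. c :: 'b::{banach, second_countable_topology})"
proof -
  have "integrable (mu r) (\<lambda>_. 1 :: real)"
    using set_integrable_exp[OF assms] unfolding set_integrable_def
    by (subst integrable_mu_iff) auto
  then have "integrable (mu r) (\<lambda>_. (1 :: real) *\<^sub>R c)"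
    by (intro integrable_scaleR_left)
  then show ?thesis by simp
qed

lemma integrable_mu_bounded:
  fixes f :: "real \<Rightarrow> 'b::{banach, second_countable_topology}"
  assumes r: "r > 0" and "f \<in> borel_measurable (mu r)" "\<And>t. t \<ge> 0 \<Longrightarrow> norm (f t) \<le> B"
  shows "integrable (mu r) f"
proof (rule Bochner_Integration.integrable_bound[OF integrable_mu_const[OF r, of B]])
  show "AE t in mu r. norm (f t) \<le> norm B"
    unfolding AE_mu_iff using assms(3) by (intro AE_I2) (force intro: order_trans)
qed fact

lemma L2_bounded:
  assumes r: "r > 0" and [measurable]: "f \<in> borel_measurable (mu r)" and "\<And>t. t \<ge> 0 \<Longrightarrow> norm (f t) \<le> B"
  shows "f \<in> L2 r"
  unfolding L2_def using assms(2-3) power_mono[OF assms(3), of _ 2]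
  by (auto intro!: integrable_mu_bounded[OF r, of _ "B\<^sup>2"])

text \<open>The measure is finite, so the constant 1 is square-integrable and can be paired with
  \<open>f\<close>. Applied to x, this makes the series behind \<open>avg\<close> converge on almost
  every fibre.\<close>

lemma L2_integrable:
  assumes r: "r > 0" and "f \<in> L2 r"
  shows "integrable (mu r) f"
  using L2_scaleR_integrable[of "\<lambda>_. 1", OF _ _ assms(2)] integrable_mu_const[OF r, of "1::real"] by simp

lemma integrable_mu_square:
  assumes r: "r > 0"
  shows "integrable (mu r) (\<lambda>t. t\<^sup>2)"
proof -
  \<comment> \<open>Half of the exponential decay pays for the square: the quadratic Taylor term of
    exp at r t / 2 is r^2 t^2 / 8, hence the constant 8 / r^2.\<close>
  have "exp (- r * t) * t\<^sup>2 \<le> 8 / r\<^sup>2 * exp (- (r/2) * t)" if "t \<ge> 0" for t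
  proof -
    have "(r * t / 2)\<^sup>2 / 2 \<le> exp (r * t / 2)"
    proof -
      have "0 \<le> r * t / 2" using r that by simp
      then show ?thesis using exp_lower_Taylor_quadratic[of "r * t / 2"] by linarith
    qed
    then have "8 / r\<^sup>2 * ((r * t / 2)\<^sup>2 / 2) \<le> 8 / r\<^sup>2 * exp (r * t / 2)"
      by (rule mult_left_mono) simp
    moreover have "8 / r\<^sup>2 * ((r * t / 2)\<^sup>2 / 2) = t\<^sup>2"
      using r by (simp add: field_simps)
    ultimately have "t\<^sup>2 \<le> 8 / r\<^sup>2 * exp (r * t / 2)" by simp
    then have "exp (- r * t) * t\<^sup>2 \<le> exp (- r * t) * (8 / r\<^sup>2 * exp (r * t / 2))"
      by (intro mult_left_mono) auto
    also have "\<dots> = 8 / r\<^sup>2 * exp (- (r/2) * t)"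
      by (simp flip: exp_add)
    finally show ?thesis .
  qed
  then have b: "norm (indicator {0..} t *\<^sub>R (exp (- r * t) *\<^sub>R t\<^sup>2)) \<le>
      norm (8 / r\<^sup>2 * (indicator {0..} t *\<^sub>R exp (- (r/2) * t)))" for t
    by (auto simp: indicator_def abs_mult)
  have m: "(\<lambda>t::real. t\<^sup>2) \<in> borel_measurable (mu r)" by (intro measurable_mu_borel) auto
  have "integrable lebesgue (\<lambda>t. 8 / r\<^sup>2 * (indicator {0..} t *\<^sub>R exp (- (r/2) * t)))"
    using set_integrable_exp[of "r/2"] r unfolding set_integrable_def by (intro integrable_mult_right) auto
  then have "integrable lebesgue (\<lambda>t. indicator {0..} t *\<^sub>R (exp (- r * t) *\<^sub>R t\<^sup>2))"
  proof (rule Bochner_Integration.integrable_bound)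
    show "(\<lambda>t. indicator {0..} t *\<^sub>R (exp (- r * t) *\<^sub>R t\<^sup>2)) \<in> borel_measurable lebesgue"
      by (intro measurable_completion) simp
    show "AE t in lebesgue. norm (indicator {0..} t *\<^sub>R (exp (- r * t) *\<^sub>R t\<^sup>2)) \<le>
      norm (8 / r\<^sup>2 * (indicator {0..} t *\<^sub>R exp (- (r/2) * t)))"
      using b by (rule AE_I2)
  qed
  then show ?thesis unfolding integrable_mu_iff[OF m] .
qed

section \<open>The averaging projection\<close>

text \<open>The index of the period containing t. Multiplying a function by it before folding
  produces the factor k of \<open>avg_tilde\<close>.\<close>

definition level :: "real \<Rightarrow> real \<Rightarrow> real" where
  "level T t = real_of_int \<lfloor>t / T\<rfloor>"

definition drift :: "real \<Rightarrow> real \<Rightarrow> real \<Rightarrow> real" where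
  "drift r T t = T * (level T t - exp (- r * T) / (1 - exp (- r * T)))"

lemma measurable_level [measurable]: "level T \<in> borel_measurable borel"
  unfolding level_def by measurable

lemma measurable_drift [measurable]: "drift r T \<in> borel_measurable borel"
  unfolding drift_def by measurable

lemma periodic_shift:
  fixes T :: real
  assumes "T > 0" "\<And>t. t \<ge> 0 \<Longrightarrow> f (t + T) = f t" "s \<ge> 0"
  shows "f (s + real k * T) = f s"
proof (induction k)
  case (Suc k)
  have "f (s + real (Suc k) * T) = f ((s + real k * T) + T)" by (simp add: algebra_simps)
  also have "\<dots> = f (s + real k * T)" using assms by (intro assms(2)) auto
  finally show ?case using Suc by simp
qed simp

context
  fixes T :: real
  assumes T: "T > 0"
begin

lemma level_shift: "s \<in> {0..<T} \<Longrightarrow> level T (s + real k * T) = real k"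
proof -
  assume s: "s \<in> {0..<T}"
  have "(s + real k * T) / T = s / T + of_int (int k)" using T by (simp add: field_simps)
  then have "\<lfloor>(s + real k * T) / T\<rfloor> = \<lfloor>s / T\<rfloor> + int k" by simp
  moreover have "\<lfloor>s / T\<rfloor> = 0" using s T by (auto simp: floor_eq_iff)
  ultimately show ?thesis by (simp add: level_def)
qed

lemma drift_shift:
  "s \<in> {0..<T} \<Longrightarrow> drift r T (s + real k * T) = T * (real k - exp (- r * T) / (1 - exp (- r * T)))"
  unfolding drift_def by (simp add: level_shift)

lemma periodic_ext_shift: "s \<in> {0..<T} \<Longrightarrow> periodic_ext T f (s + real k * T) = f s"
  using level_shift[of s k] by (simp add: periodic_ext_def level_def)

lemma periodic_ext_periodic: "periodic_ext T f (t + T) = periodic_ext T f t"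
proof -
  have "(t + T) / T = t / T + of_int 1" using T by (simp add: field_simps)
  then have "\<lfloor>(t + T) / T\<rfloor> = \<lfloor>t / T\<rfloor> + 1" by (simp only: floor_add_int[symmetric])
  then show ?thesis by (simp add: periodic_ext_def algebra_simps)
qed

lemma level_bounds: "t \<ge> 0 \<Longrightarrow> 0 \<le> level T t" "level T t \<le> t / T"
  "0 \<le> t - level T t * T" "t - level T t * T < T"
proof -
  show "t \<ge> 0 \<Longrightarrow> 0 \<le> level T t" "level T t \<le> t / T" using T by (auto simp: level_def)
  then show "0 \<le> t - level T t * T" using T by (simp add: field_simps)
  have "t / T < level T t + 1" unfolding level_def by linarith
  then show "t - level T t * T < T" using T by (simp add: field_simps)
qed

text \<open>The extension is written as a series of translates of \<open>f\<close> cut to [0, T):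
  one nonzero term at most for t \<ge> 0, none for t < 0. This avoids composing a merely
  Lebesgue-measurable \<open>f\<close> with the floor-based period part.\<close>

lemma measurable_periodic_ext:
  assumes f: "(\<lambda>s. indicator {0..<T} s *\<^sub>R f s) \<in> borel_measurable lebesgue"
  shows "periodic_ext T f \<in> borel_measurable (mu r)"
proof -
  define g where "g = (\<lambda>s. indicator {0..<T} s *\<^sub>R f s)"
  have "indicator {0..} t *\<^sub>R periodic_ext T f t = (\<Sum>k. g (t + - (real k * T)))" for t
  proof (cases "t \<ge> 0")
    case True
    define n where "n = nat \<lfloor>t / T\<rfloor>"
    have n: "level T t = real n" using True level_bounds(1)[of t] by (simp add: n_def level_def)
    have "(\<lambda>k. g (t + - (real k * T))) = (\<lambda>k. if k = n then periodic_ext T f t else 0)"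
    proof
      fix k
      have "indicator {0..<T} (t + - (real k * T)) = (indicator {real k * T..<real k * T + T} t :: real)"
        by (auto simp: indicator_def)
      then show "g (t + - (real k * T)) = (if k = n then periodic_ext T f t else 0)"
        using indicator_period[OF T True, of k] n
        by (auto simp: g_def n_def[symmetric] periodic_ext_def level_def[symmetric])
    qed
    then have "(\<lambda>k. g (t + - (real k * T))) sums periodic_ext T f t"
      using sums_single[of n "\<lambda>_. periodic_ext T f t"] by simp
    then show ?thesis using True by (simp add: sums_iff)
  next
    case False
    have "t - real k * T < 0" for k using False T mult_nonneg_nonneg[of "real k" T] by linarith
    then have "g (t + - (real k * T)) = 0" for k by (simp add: g_def indicator_def not_le)
    then show ?thesis using False by simp
  qed
  moreover have "(\<lambda>t. \<Sum>k. g (t + - (real k * T))) \<in> borel_measurable lebesgue"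
    using f unfolding g_def[symmetric]
    by (intro borel_measurable_suminf) (rule borel_measurable_lebesgue_translation)
  ultimately show ?thesis unfolding borel_measurable_mu_iff by simp
qed

lemma measurable_avg: "x \<in> borel_measurable (mu r) \<Longrightarrow>
    (\<lambda>s. indicator {0..<T} s *\<^sub>R avg r T x s) \<in> borel_measurable lebesgue"
proof -
  assume x: "x \<in> borel_measurable (mu r)"
  have "(\<lambda>s. (1 - exp (- r * T)) *\<^sub>R (indicator {0..<T} s *\<^sub>R (\<Sum>k. exp (- r * real k * T) *\<^sub>R x (s + real k * T))))
    \<in> borel_measurable lebesgue"
    by (intro borel_measurable_scaleR borel_measurable_const measurable_fold[OF T x])
  then show ?thesis by (simp add: avg_def mult.commute)
qed

end

section \<open>Jensen's inequality on fibres and square-integrability of the projection\<close>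

context
  fixes r T :: real
  assumes r: "r > 0" and T: "T > 0"
begin

text \<open>Jensen's inequality for the probability weights (1 - q) q^k. It comes from expanding the
  nonnegative weighted sum of the squares \<open>norm (v k - m)\<close> around the mean m: the cross
  term contributes twice what the last term gives back.\<close>

lemma avg_square_le:
  assumes s1: "summable (\<lambda>k. exp (- r * real k * T) * norm (x (s + real k * T)))"
    and s2: "summable (\<lambda>k. exp (- r * real k * T) * (norm (x (s + real k * T)))\<^sup>2)"
  shows "(norm (avg r T x s))\<^sup>2 \<le>
    (1 - exp (- r * T)) * (\<Sum>k. exp (- r * real k * T) * (norm (x (s + real k * T)))\<^sup>2)"
proof -
  define q w v m where "q = exp (- r * T)" and "w = (\<lambda>k. exp (- r * real k * T))"
    and "v = (\<lambda>k. x (s + real k * T))" and "m = avg r T x s"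
  have q: "0 < 1 - q" using q_bounds[OF r T] by (simp add: q_def)
  have "summable (\<lambda>k. w k *\<^sub>R v k)"
    using s1 by - (rule summable_norm_cancel, simp add: w_def v_def)
  moreover have "m = (1 - q) *\<^sub>R (\<Sum>k. w k *\<^sub>R v k)"
    by (simp add: m_def avg_def w_def v_def q_def)
  then have "m /\<^sub>R (1 - q) = (\<Sum>k. w k *\<^sub>R v k)" using q by simp
  ultimately have 1: "(\<lambda>k. w k *\<^sub>R v k) sums (m /\<^sub>R (1 - q))"
    by (simp add: sums_iff)
  have "(\<lambda>k. (w k *\<^sub>R v k) \<bullet> m) sums ((m /\<^sub>R (1 - q)) \<bullet> m)"
    using bounded_linear.sums[OF bounded_linear_inner_left 1] .
  then have 2: "(\<lambda>k. 2 * (w k * (v k \<bullet> m))) sums (2 * ((norm m)\<^sup>2 / (1 - q)))"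
    by (intro sums_mult) (simp add: power2_norm_eq_inner divide_inverse mult.commute)
  have 3: "(\<lambda>k. (norm m)\<^sup>2 * w k) sums ((norm m)\<^sup>2 * (1 / (1 - q)))"
    unfolding w_def q_def by (intro sums_mult sums_q[OF r T])
  have 4: "(\<lambda>k. w k * (norm (v k))\<^sup>2) sums (\<Sum>k. w k * (norm (v k))\<^sup>2)"
    using s2 by (simp add: summable_sums w_def v_def)
  have "(\<lambda>k. w k * (norm (v k - m))\<^sup>2) = (\<lambda>k. w k * (norm (v k))\<^sup>2 - 2 * (w k * (v k \<bullet> m)) + (norm m)\<^sup>2 * w k)"
    by (simp add: power2_norm_eq_inner inner_diff inner_commute algebra_simps)
  then have "(\<lambda>k. w k * (norm (v k - m))\<^sup>2) sums
    ((\<Sum>k. w k * (norm (v k))\<^sup>2) - 2 * ((norm m)\<^sup>2 / (1 - q)) + (norm m)\<^sup>2 * (1 / (1 - q)))"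
    using sums_add[OF sums_diff[OF 4 2] 3] by simp
  then have "0 \<le> (\<Sum>k. w k * (norm (v k))\<^sup>2) - 2 * ((norm m)\<^sup>2 / (1 - q)) + (norm m)\<^sup>2 * (1 / (1 - q))"
    by (rule sums_le[OF _ sums_zero, rotated]) (simp add: w_def)
  then have "(norm m)\<^sup>2 / (1 - q) \<le> (\<Sum>k. w k * (norm (v k))\<^sup>2)" by simp
  then have "(norm m)\<^sup>2 \<le> (1 - q) * (\<Sum>k. w k * (norm (v k))\<^sup>2)"
    using q by (simp add: pos_divide_le_eq mult.commute)
  then show ?thesis by (simp add: m_def q_def w_def v_def)
qed

text \<open>The fibrewise Jensen bound is integrable over one period, because its right side is the
  folded squared norm of x; periodicity carries the estimate to the half-line. Integrability of x
  itself supplies convergence of the averaged series.\<close>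

lemma L2_avg:
  assumes x: "x \<in> L2 r"
  shows "periodic_ext T (avg r T x) \<in> L2 r"
proof -
  note xm = L2_D(1)[OF x]
  have m: "periodic_ext T (avg r T x) \<in> borel_measurable (mu r)"
    by (intro measurable_periodic_ext[OF T] measurable_avg[OF T] xm)
  have "integrable (mu r) (\<lambda>t. (norm (periodic_ext T (avg r T x) t))\<^sup>2)"
  proof (rule integrable_mu_periodic[OF r T])
    show "(\<lambda>t. (norm (periodic_ext T (avg r T x) t))\<^sup>2) \<in> borel_measurable (mu r)"
      using m by measurable
    show "(norm (periodic_ext T (avg r T x) (s + real k * T)))\<^sup>2 = (norm (periodic_ext T (avg r T x) s))\<^sup>2"
      if "s \<in> {0..<T}" for s k
      using that periodic_ext_shift[OF T that, of "avg r T x" 0] by (simp add: periodic_ext_shift[OF T])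
    note fold1 = mu_fold(1)[OF r T L2_integrable[OF r x]]
    note fold2 = mu_fold[OF r T L2_D(2)[OF x]]
    show "set_integrable lebesgue {0..<T} (\<lambda>s. exp (- r * s) * (norm (periodic_ext T (avg r T x) s))\<^sup>2)"
      unfolding set_integrable_def
    proof (rule Bochner_Integration.integrable_bound)
      show "integrable lebesgue (\<lambda>s. (1 - exp (- r * T)) * (indicator {0..<T} s *\<^sub>R
          (exp (- r * s) *\<^sub>R (\<Sum>k. exp (- r * real k * T) *\<^sub>R (norm (x (s + real k * T)))\<^sup>2))))"
        using fold2(2) unfolding set_integrable_def by (rule integrable_mult_right)
      have "(\<lambda>s. exp (- r * s) * (norm (indicator {0..<T} s *\<^sub>R avg r T x s))\<^sup>2) \<in> borel_measurable lebesgue"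
        by (intro borel_measurable_times borel_measurable_power
            measurable_compose[OF measurable_avg[OF T xm] borel_measurable_norm])
          (simp add: measurable_completion)
      also have "(\<lambda>s. exp (- r * s) * (norm (indicator {0..<T} s *\<^sub>R avg r T x s))\<^sup>2) =
        (\<lambda>s. indicator {0..<T} s *\<^sub>R (exp (- r * s) * (norm (periodic_ext T (avg r T x) s))\<^sup>2))"
        using periodic_ext_shift[OF T, of _ "avg r T x" 0] by (intro ext) (auto simp: indicator_def)
      finally show "(\<lambda>s. indicator {0..<T} s *\<^sub>R (exp (- r * s) * (norm (periodic_ext T (avg r T x) s))\<^sup>2))
        \<in> borel_measurable lebesgue" .
      show "AE s in lebesgue. norm (indicator {0..<T} s *\<^sub>R (exp (- r * s) * (norm (periodic_ext T (avg r T x) s))\<^sup>2)) \<le>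
        norm ((1 - exp (- r * T)) * (indicator {0..<T} s *\<^sub>R
          (exp (- r * s) *\<^sub>R (\<Sum>k. exp (- r * real k * T) *\<^sub>R (norm (x (s + real k * T)))\<^sup>2))))"
        using fold1 fold2(1)
      proof eventually_elim
        case (elim s)
        show ?case
        proof (cases "s \<in> {0..<T}")
          case True
          have "exp (- r * s) * (norm (avg r T x s))\<^sup>2 \<le> exp (- r * s) * ((1 - exp (- r * T)) *
              (\<Sum>k. exp (- r * real k * T) * (norm (x (s + real k * T)))\<^sup>2))"
            using elim True by (intro mult_left_mono avg_square_le) auto
          also have "\<dots> \<le> norm ((1 - exp (- r * T)) * (exp (- r * s) *\<^sub>R
              (\<Sum>k. exp (- r * real k * T) *\<^sub>R (norm (x (s + real k * T)))\<^sup>2)))"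
            by (simp add: mult.left_commute)
          finally show ?thesis using True periodic_ext_shift[OF T True, of "avg r T x" 0] by simp
        qed simp
      qed
    qed
  qed simp
  with m show ?thesis by (simp add: L2_def)
qed

text \<open>For an integrand that splits on fibres into a factor of k and a factor of s, the
  integral becomes a product. It reduces the total mass of \<open>mu r\<close>, the orthogonality of
  the drift and its norm to numerical series.\<close>

lemma integral_mu_separated:
  fixes f g :: "real \<Rightarrow> 'b::{banach, second_countable_topology}"
  assumes f: "integrable (mu r) f"
    and shift: "\<And>s k. s \<in> {0..<T} \<Longrightarrow> f (s + real k * T) = c k *\<^sub>R g s"
    and c: "(\<lambda>k. exp (- r * real k * T) * c k) sums C"
  shows "integral\<^sup>L (mu r) f = C *\<^sub>R (LINT s:{0..<T}|lebesgue. exp (- r * s) *\<^sub>R g s)"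
proof -
  have "integral\<^sup>L (mu r) f =
    (LINT s:{0..<T}|lebesgue. exp (- r * s) *\<^sub>R (\<Sum>k. exp (- r * real k * T) *\<^sub>R f (s + real k * T)))"
    by (rule mu_fold(3)[OF r T f])
  also have "\<dots> = (LINT s:{0..<T}|lebesgue. C *\<^sub>R (exp (- r * s) *\<^sub>R g s))"
  proof (intro set_lebesgue_integral_cong allI impI)
    fix s assume s: "s \<in> {0..<T}"
    have "(\<lambda>k. (exp (- r * real k * T) * c k) *\<^sub>R g s) sums (C *\<^sub>R g s)"
      by (intro sums_scaleR_left c)
    then have "(\<Sum>k. exp (- r * real k * T) *\<^sub>R f (s + real k * T)) = C *\<^sub>R g s"
      using s by (simp add: shift sums_iff)
    then show "exp (- r * s) *\<^sub>R (\<Sum>k. exp (- r * real k * T) *\<^sub>R f (s + real k * T)) =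
      C *\<^sub>R (exp (- r * s) *\<^sub>R g s)" by simp
  qed simp
  also have "\<dots> = C *\<^sub>R (LINT s:{0..<T}|lebesgue. exp (- r * s) *\<^sub>R g s)"
    by (rule set_integral_scaleR_right)
  finally show ?thesis .
qed

end

section \<open>The drift\<close>

lemma drift_measurable_mu: "drift r T \<in> borel_measurable (mu r)"
  by (intro measurable_mu_borel) measurable

lemma level_measurable_mu: "level T \<in> borel_measurable (mu r)"
  by (intro measurable_mu_borel) measurable

text \<open>Tiling forces half-open periods, whereas the formula for a integrates over the closed
  one; the two differ by the null set {T}.\<close>

lemma set_lebesgue_closed:
  fixes f :: "real \<Rightarrow> 'b::euclidean_space"
  assumes "set_integrable lebesgue {0..<T} f"
  shows "set_integrable lebesgue {0..T} f"
    and "(LINT s:{0..T}|lebesgue. f s) = (LINT s:{0..<T}|lebesgue. f s)"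
proof -
  have n: "negligible {x \<in> {0..<T} - {0..T}. f x \<noteq> 0}" "negligible {x \<in> {0..T} - {0..<T}. f x \<noteq> 0}"
  proof -
    have "{x \<in> {0..T} - {0..<T}. f x \<noteq> 0} \<subseteq> {T}" by auto
    then show "negligible {x \<in> {0..T} - {0..<T}. f x \<noteq> 0}" using negligible_subset negligible_sing by blast
    have "{x \<in> {0..<T} - {0..T}. f x \<noteq> 0} = {}" by auto
    then show "negligible {x \<in> {0..<T} - {0..T}. f x \<noteq> 0}" by (simp only: negligible_empty)
  qed
  show i: "set_integrable lebesgue {0..T} f"
    using assms absolutely_integrable_spike_set_eq[OF n] by simp
  show "(LINT s:{0..T}|lebesgue. f s) = (LINT s:{0..<T}|lebesgue. f s)"
    unfolding set_lebesgue_integral_eq_integral(2)[OF i] set_lebesgue_integral_eq_integral(2)[OF assms]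
    by (rule integral_spike_set[OF n(2,1)])
qed

section \<open>Orthogonality and moments on fibres\<close>

context
  fixes r T :: real
  assumes r: "r > 0" and T: "T > 0"
begin

lemma level_square_integrable: "integrable (mu r) (\<lambda>t. (level T t)\<^sup>2)"
proof (rule Bochner_Integration.integrable_bound)
  show "integrable (mu r) (\<lambda>t. t\<^sup>2 / T\<^sup>2)" using integrable_mu_square[OF r] by simp
  show "(\<lambda>t. (level T t)\<^sup>2) \<in> borel_measurable (mu r)" by (intro measurable_mu_borel) measurable
  have "(level T t)\<^sup>2 \<le> t\<^sup>2 / T\<^sup>2" if "t \<ge> 0" for t
    using power_mono[OF level_bounds(2)[OF T, of t] level_bounds(1)[OF T that], of 2]
    by (simp add: power_divide)
  then show "AE t in mu r. norm ((level T t)\<^sup>2) \<le> norm (t\<^sup>2 / T\<^sup>2)"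
    unfolding AE_mu_iff by simp
qed

lemma drift_square_integrable: "integrable (mu r) (\<lambda>t. (drift r T t)\<^sup>2)"
proof -
  define c where "c = exp (- r * T) / (1 - exp (- r * T))"
  have "integrable (mu r) (\<lambda>t. level T t * 1)"
    using level_square_integrable integrable_mu_const[OF r, of "1::real"] level_measurable_mu
    by (intro integrable_mu_mult_of_squares) auto
  then have "integrable (mu r) (\<lambda>t. T\<^sup>2 * (level T t)\<^sup>2 - 2 * T\<^sup>2 * c * level T t + T\<^sup>2 * c\<^sup>2)"
    using level_square_integrable integrable_mu_const[OF r, of "T\<^sup>2 * c\<^sup>2"] by simp
  also have "(\<lambda>t. T\<^sup>2 * (level T t)\<^sup>2 - 2 * T\<^sup>2 * c * level T t + T\<^sup>2 * c\<^sup>2) = (\<lambda>t. (drift r T t)\<^sup>2)"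
    unfolding drift_def c_def[symmetric] by (simp add: power2_eq_square algebra_simps)
  finally show ?thesis .
qed

text \<open>This is what makes averaging an orthogonal projection. On a fibre \<open>g\<close> is
  constant, so x enters only through its weighted sum S. The average is the constant (1 - q) S,
  whose weighted sum is again S because the weights add up to 1 / (1 - q).\<close>

lemma integral_inner_avg:
  assumes x: "x \<in> L2 r" and g: "g \<in> L2 r" and per: "\<And>t. t \<ge> 0 \<Longrightarrow> g (t + T) = g t"
  shows "(LINT t|mu r. x t \<bullet> g t) = (LINT t|mu r. periodic_ext T (avg r T x) t \<bullet> g t)"
proof -
  have g_shift: "g (s + real k * T) = g s" if "s \<in> {0..<T}" for s k
    using that by (intro periodic_shift[of T g, OF T per]) auto
  note Px = L2_inner_integrable[OF L2_avg[OF r T x] g]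
  have "(LINT t|mu r. x t \<bullet> g t) = (LINT s:{0..<T}|lebesgue.
    exp (- r * s) *\<^sub>R (\<Sum>k. exp (- r * real k * T) *\<^sub>R (x (s + real k * T) \<bullet> g (s + real k * T))))"
    by (rule mu_fold(3)[OF r T L2_inner_integrable[OF x g]])
  also have "\<dots> = (LINT s:{0..<T}|lebesgue.
    exp (- r * s) *\<^sub>R (\<Sum>k. exp (- r * real k * T) *\<^sub>R (periodic_ext T (avg r T x) (s + real k * T) \<bullet> g (s + real k * T))))"
    unfolding set_lebesgue_integral_def
  proof (rule integral_cong_AE)
    show "(\<lambda>s. indicator {0..<T} s *\<^sub>R (exp (- r * s) *\<^sub>R
        (\<Sum>k. exp (- r * real k * T) *\<^sub>R (x (s + real k * T) \<bullet> g (s + real k * T))))) \<in> borel_measurable lebesgue"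
      using mu_fold(2)[OF r T L2_inner_integrable[OF x g]] unfolding set_integrable_def by (rule borel_measurable_integrable)
    show "(\<lambda>s. indicator {0..<T} s *\<^sub>R (exp (- r * s) *\<^sub>R (\<Sum>k. exp (- r * real k * T) *\<^sub>R
        (periodic_ext T (avg r T x) (s + real k * T) \<bullet> g (s + real k * T))))) \<in> borel_measurable lebesgue"
      using mu_fold(2)[OF r T Px] unfolding set_integrable_def by (rule borel_measurable_integrable)
    show "AE s in lebesgue. indicator {0..<T} s *\<^sub>R (exp (- r * s) *\<^sub>R
        (\<Sum>k. exp (- r * real k * T) *\<^sub>R (x (s + real k * T) \<bullet> g (s + real k * T)))) =
      indicator {0..<T} s *\<^sub>R (exp (- r * s) *\<^sub>R (\<Sum>k. exp (- r * real k * T) *\<^sub>R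
        (periodic_ext T (avg r T x) (s + real k * T) \<bullet> g (s + real k * T))))"
      using mu_fold(1)[OF r T L2_integrable[OF r x]]
    proof eventually_elim
      case (elim s)
      show ?case
      proof (cases "s \<in> {0..<T}")
        case s: True
        define S where "S = (\<Sum>k. exp (- r * real k * T) *\<^sub>R x (s + real k * T))"
        have avg: "avg r T x s = (1 - exp (- r * T)) *\<^sub>R S" by (simp add: avg_def S_def)
        have "summable (\<lambda>k. exp (- r * real k * T) *\<^sub>R x (s + real k * T))"
          using elim s by - (rule summable_norm_cancel, simp)
        then have "(\<lambda>k. exp (- r * real k * T) *\<^sub>R x (s + real k * T)) sums S"
          by (simp add: S_def summable_sums)
        from bounded_linear.sums[OF bounded_linear_inner_left this, of "g s"]
        have 1: "(\<lambda>k. exp (- r * real k * T) *\<^sub>R (x (s + real k * T) \<bullet> g (s + real k * T))) sums (S \<bullet> g s)"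
          by (simp add: g_shift[OF s])
        have "(\<lambda>k. exp (- r * real k * T) *\<^sub>R (avg r T x s \<bullet> g s)) sums ((1 / (1 - exp (- r * T))) *\<^sub>R (avg r T x s \<bullet> g s))"
          by (intro sums_scaleR_left sums_q[OF r T])
        moreover have "(1 / (1 - exp (- r * T))) *\<^sub>R (avg r T x s \<bullet> g s) = S \<bullet> g s"
          using r T by (simp add: avg)
        ultimately have 2: "(\<lambda>k. exp (- r * real k * T) *\<^sub>R
          (periodic_ext T (avg r T x) (s + real k * T) \<bullet> g (s + real k * T))) sums (S \<bullet> g s)"
          by (simp add: g_shift[OF s] periodic_ext_shift[OF T s])
        show ?thesis using sums_unique[OF 1] sums_unique[OF 2] by simp
      qed simp
    qed
  qed
  also have "\<dots> = (LINT t|mu r. periodic_ext T (avg r T x) t \<bullet> g t)"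
    by (rule mu_fold(3)[OF r T Px, symmetric])
  finally show ?thesis .
qed

lemma sums_weighted_k: "(\<lambda>k. exp (- r * real k * T) * real k) sums (exp (- r * T) / (1 - exp (- r * T))\<^sup>2)"
  "(\<lambda>k. exp (- r * real k * T) * (real k)\<^sup>2) sums (exp (- r * T) * (1 + exp (- r * T)) / (1 - exp (- r * T)) ^ 3)"
  using sums_k_power[OF q_bounds[OF r T]] unfolding exp_power by (simp_all add: mult.commute)

text \<open>The centred geometric index has mean 0 and variance q / (1 - q)^2. The weights are not
  normalised, so the variance is divided by a further 1 - q, whence the exponent 3.\<close>

lemma sums_weighted_drift:
  "(\<lambda>k. exp (- r * real k * T) * (T * (real k - exp (- r * T) / (1 - exp (- r * T))))) sums 0"
  "(\<lambda>k. exp (- r * real k * T) * (T * (real k - exp (- r * T) / (1 - exp (- r * T))))\<^sup>2) sums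
    (T\<^sup>2 * exp (- r * T) / (1 - exp (- r * T)) ^ 3)"
proof -
  define q c w where "q = exp (- r * T)" and "c = q / (1 - q)" and "w = (\<lambda>k. exp (- r * real k * T))"
  have q: "1 - q \<noteq> 0" using q_bounds[OF r T] unfolding q_def by linarith
  have s0: "w sums (1 / (1 - q))" unfolding w_def q_def by (rule sums_q[OF r T])
  have s1: "(\<lambda>k. w k * real k) sums (q / (1 - q)\<^sup>2)" unfolding w_def q_def by (rule sums_weighted_k)
  have s2: "(\<lambda>k. w k * (real k)\<^sup>2) sums (q * (1 + q) / (1 - q) ^ 3)" unfolding w_def q_def by (rule sums_weighted_k)
  have "(\<lambda>k. T * (w k * real k) - T * c * w k) sums (T * (q / (1 - q)\<^sup>2) - T * c * (1 / (1 - q)))"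
    by (intro sums_diff sums_mult s0 s1)
  moreover have "T * (q / (1 - q)\<^sup>2) - T * c * (1 / (1 - q)) = 0" by (simp add: c_def power2_eq_square)
  ultimately have "(\<lambda>k. w k * (T * (real k - c))) sums 0" by (simp add: algebra_simps)
  then show "(\<lambda>k. exp (- r * real k * T) * (T * (real k - exp (- r * T) / (1 - exp (- r * T))))) sums 0"
    by (simp add: w_def c_def q_def)
  have "(\<lambda>k. T\<^sup>2 * (w k * (real k)\<^sup>2) - 2 * T\<^sup>2 * c * (w k * real k) + T\<^sup>2 * c\<^sup>2 * w k) sums
    (T\<^sup>2 * (q * (1 + q) / (1 - q) ^ 3) - 2 * T\<^sup>2 * c * (q / (1 - q)\<^sup>2) + T\<^sup>2 * c\<^sup>2 * (1 / (1 - q)))"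
    by (intro sums_add sums_diff sums_mult s0 s1 s2)
  moreover have "T\<^sup>2 * (q * (1 + q) / p ^ 3) - 2 * T\<^sup>2 * (q / p) * (q / p\<^sup>2) + T\<^sup>2 * (q / p)\<^sup>2 * (1 / p) = T\<^sup>2 * q / p ^ 3"
    if "p \<noteq> 0" for p
    using that by (simp add: field_simps power2_eq_square power3_eq_cube)
  from this[OF q] have "T\<^sup>2 * (q * (1 + q) / (1 - q) ^ 3) - 2 * T\<^sup>2 * c * (q / (1 - q)\<^sup>2) + T\<^sup>2 * c\<^sup>2 * (1 / (1 - q)) =
    T\<^sup>2 * q / (1 - q) ^ 3" unfolding c_def .
  moreover have "T\<^sup>2 * (w k * (real k)\<^sup>2) - 2 * T\<^sup>2 * c * (w k * real k) + T\<^sup>2 * c\<^sup>2 * w k = w k * (T * (real k - c))\<^sup>2" for k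
    by (simp add: power2_eq_square algebra_simps)
  ultimately show "(\<lambda>k. exp (- r * real k * T) * (T * (real k - exp (- r * T) / (1 - exp (- r * T))))\<^sup>2) sums
    (T\<^sup>2 * exp (- r * T) / (1 - exp (- r * T)) ^ 3)"
    by (simp add: w_def c_def q_def)
qed

text \<open>A periodic \<open>u\<close> is constant on each fibre, where the weighted sum of the
  drift is 0.\<close>

lemma drift_orthogonal:
  assumes um: "u \<in> borel_measurable (mu r)" and ui: "integrable (mu r) (\<lambda>t. (u t)\<^sup>2)"
    and per: "\<And>t. t \<ge> 0 \<Longrightarrow> u (t + T) = u t"
  shows "(LINT t|mu r. drift r T t * u t) = 0"
proof -
  have "(LINT t|mu r. drift r T t * u t) = 0 *\<^sub>R (LINT s:{0..<T}|lebesgue. exp (- r * s) *\<^sub>R u s)"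
  proof (rule integral_mu_separated[OF r T _ _ sums_weighted_drift(1)])
    show "integrable (mu r) (\<lambda>t. drift r T t * u t)"
      by (intro integrable_mu_mult_of_squares drift_measurable_mu drift_square_integrable um ui)
    show "drift r T (s + real k * T) * u (s + real k * T) =
      (T * (real k - exp (- r * T) / (1 - exp (- r * T)))) *\<^sub>R u s" if "s \<in> {0..<T}" for s k
      using that periodic_shift[of T u s k, OF T per] by (simp add: drift_shift[OF T])
  qed
  then show ?thesis by simp
qed

text \<open>The total mass 1 / r of \<open>mu r\<close> is folded: it equals 1 / (1 - q) times the
  mass of one period.\<close>

lemma integral_exp_period: "(LINT s:{0..<T}|lebesgue. exp (- r * s) *\<^sub>R (1::real)) = (1 - exp (- r * T)) / r"
proof -
  have "((\<lambda>t. exp (- r * t)) has_integral 1 / r) {0..}"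
    using has_integral_exp_minus_to_infinity[OF r, of 0] by simp
  then have "(LINT t:{0..}|lebesgue. exp (- r * t)) = 1 / r"
    using set_lebesgue_integral_eq_integral(2)[OF set_integrable_exp[OF r]] by (simp add: integral_unique)
  then have "integral\<^sup>L (mu r) (\<lambda>_. 1::real) = 1 / r"
    by (subst integral_mu_eq) (simp_all add: set_lebesgue_integral_def)
  moreover have "integral\<^sup>L (mu r) (\<lambda>_. 1::real) = (1 / (1 - exp (- r * T))) *\<^sub>R (LINT s:{0..<T}|lebesgue. exp (- r * s) *\<^sub>R 1)"
    by (rule integral_mu_separated[OF r T, where c = "\<lambda>_. 1"])
      (use integrable_mu_const[OF r, of "1::real"] sums_q[OF r T] in auto)
  ultimately show ?thesis using q_bounds[OF r T] r by (simp add: field_simps)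
qed

lemma integral_drift_square:
  "(LINT t|mu r. (drift r T t)\<^sup>2) = T\<^sup>2 * exp (- r * T) / ((1 - exp (- r * T))\<^sup>2 * r)"
proof -
  have "(LINT t|mu r. (drift r T t)\<^sup>2) = (T\<^sup>2 * exp (- r * T) / (1 - exp (- r * T)) ^ 3) *\<^sub>R
    (LINT s:{0..<T}|lebesgue. exp (- r * s) *\<^sub>R (1::real))"
    by (rule integral_mu_separated[OF r T drift_square_integrable _ sums_weighted_drift(2)])
      (simp add: drift_shift[OF T])
  also have "\<dots> = T\<^sup>2 * exp (- r * T) / ((1 - exp (- r * T))\<^sup>2 * r)"
  proof -
    have "a / p ^ 3 * (p / r) = a / (p\<^sup>2 * r)" if "p \<noteq> 0" for a p
      using that r by (simp add: field_simps power2_eq_square power3_eq_cube)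
    moreover have "1 - exp (- r * T) \<noteq> 0" using q_bounds[OF r T] by linarith
    ultimately show ?thesis unfolding integral_exp_period by (simp only: real_scaleR_def)
  qed
  finally show ?thesis .
qed

text \<open>The second series is the folding of \<open>level T\<close> times x, which is integrable
  as a product of two square-integrable functions. Folding speaks of [0, T); the end point T is
  discarded as a null set.\<close>

lemma AE_summable:
  assumes x: "x \<in> L2 r"
  shows "AE s in lebesgue_on {0..T}.
    summable (\<lambda>k. exp (- r * real k * T) *\<^sub>R x (s + real k * T)) \<and>
    summable (\<lambda>k. (real k * exp (- r * real k * T)) *\<^sub>R x (s + real k * T))"
proof -
  have "AE s in lebesgue. s \<noteq> T"
    by (intro AE_not_in[of "{T}", simplified]) auto
  with mu_fold(1)[OF r T L2_integrable[OF r x]]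
    mu_fold(1)[OF r T L2_scaleR_integrable[OF level_measurable_mu level_square_integrable x]]
  have "AE s in lebesgue. s \<in> {0..T} \<longrightarrow>
    summable (\<lambda>k. exp (- r * real k * T) *\<^sub>R x (s + real k * T)) \<and>
    summable (\<lambda>k. (real k * exp (- r * real k * T)) *\<^sub>R x (s + real k * T))"
  proof eventually_elim
    case (elim s)
    show ?case
    proof
      assume "s \<in> {0..T}"
      with elim have s: "s \<in> {0..<T}" by auto
      have "summable (\<lambda>k. exp (- r * real k * T) *\<^sub>R x (s + real k * T))"
        using elim s by - (rule summable_norm_cancel, simp)
      moreover have "summable (\<lambda>k. (real k * exp (- r * real k * T)) *\<^sub>R x (s + real k * T))"
        using elim s by - (rule summable_norm_cancel, simp add: level_shift[OF T s] mult.assoc mult.left_commute)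
      ultimately show "summable (\<lambda>k. exp (- r * real k * T) *\<^sub>R x (s + real k * T)) \<and>
        summable (\<lambda>k. (real k * exp (- r * real k * T)) *\<^sub>R x (s + real k * T))" ..
    qed
  qed
  then show ?thesis by (subst AE_restrict_space_iff) auto
qed

text \<open>This is the origin of the formula for a. Folding turns the drift pairing into T B - T q
  / (1 - q) A, with A the plain and B the k-weighted series. Extracting T q / (1 - q)^2 leaves (1 -
  q)^2 / q times B minus 1 - q times A, which are exactly the normalisations of
  \<open>avg_tilde\<close> and \<open>avg\<close>.\<close>

lemma integral_drift:
  assumes x: "x \<in> L2 r"
  shows "set_integrable lebesgue {0..T} (\<lambda>s. exp (- r * s) *\<^sub>R (avg_tilde r T x s - avg r T x s))"
    and "(LINT t|mu r. drift r T t *\<^sub>R x t) = (T * exp (- r * T) / (1 - exp (- r * T))\<^sup>2) *\<^sub>R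
      (LINT s:{0..T}|lebesgue. exp (- r * s) *\<^sub>R (avg_tilde r T x s - avg r T x s))"
proof -
  define q where "q = exp (- r * T)"
  have q: "q > 0" "1 - q \<noteq> 0" using q_bounds[OF r T] unfolding q_def by linarith+
  note xi = L2_integrable[OF r x]
  note lxi = L2_scaleR_integrable[OF level_measurable_mu level_square_integrable x]
  define A B where "A = (\<lambda>s. \<Sum>k. exp (- r * real k * T) *\<^sub>R x (s + real k * T))"
    and "B = (\<lambda>s. \<Sum>k. exp (- r * real k * T) *\<^sub>R (level T (s + real k * T) *\<^sub>R x (s + real k * T)))"
  have A: "set_integrable lebesgue {0..<T} (\<lambda>s. exp (- r * s) *\<^sub>R A s)"
    "integral\<^sup>L (mu r) x = (LINT s:{0..<T}|lebesgue. exp (- r * s) *\<^sub>R A s)"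
    unfolding A_def by (fact mu_fold(2)[OF r T xi], fact mu_fold(3)[OF r T xi])
  have B: "set_integrable lebesgue {0..<T} (\<lambda>s. exp (- r * s) *\<^sub>R B s)"
    "(LINT t|mu r. level T t *\<^sub>R x t) = (LINT s:{0..<T}|lebesgue. exp (- r * s) *\<^sub>R B s)"
    unfolding B_def by (fact mu_fold(2)[OF r T lxi], fact mu_fold(3)[OF r T lxi])
  have eq: "exp (- r * s) *\<^sub>R (avg_tilde r T x s - avg r T x s) =
    ((1 - q)\<^sup>2 / q) *\<^sub>R (exp (- r * s) *\<^sub>R B s) - (1 - q) *\<^sub>R (exp (- r * s) *\<^sub>R A s)" if s: "s \<in> {0..<T}" for s
  proof -
    have "avg_tilde r T x s = ((1 - q)\<^sup>2 / q) *\<^sub>R B s"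
      unfolding avg_tilde_def B_def q_def level_shift[OF T s] scaleR_scaleR by (simp only: mult.commute)
    moreover have "avg r T x s = (1 - q) *\<^sub>R A s"
      by (simp add: avg_def A_def q_def)
    ultimately show ?thesis by (simp add: scaleR_diff_right mult.commute)
  qed
  have AB: "set_integrable lebesgue {0..<T} (\<lambda>s. ((1 - q)\<^sup>2 / q) *\<^sub>R (exp (- r * s) *\<^sub>R B s))"
    "set_integrable lebesgue {0..<T} (\<lambda>s. (1 - q) *\<^sub>R (exp (- r * s) *\<^sub>R A s))"
    by (intro set_integrable_scaleR_right A B)+
  have i: "set_integrable lebesgue {0..<T} (\<lambda>s. exp (- r * s) *\<^sub>R (avg_tilde r T x s - avg r T x s))"
    using set_integral_diff(1)[OF AB] by (subst set_integrable_cong[OF refl refl eq]) auto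
  show "set_integrable lebesgue {0..T} (\<lambda>s. exp (- r * s) *\<^sub>R (avg_tilde r T x s - avg r T x s))"
    by (rule set_lebesgue_closed(1)[OF i])
  have "(LINT s:{0..T}|lebesgue. exp (- r * s) *\<^sub>R (avg_tilde r T x s - avg r T x s)) =
    (LINT s:{0..<T}|lebesgue. exp (- r * s) *\<^sub>R (avg_tilde r T x s - avg r T x s))"
    by (rule set_lebesgue_closed(2)[OF i])
  also have "\<dots> = (LINT s:{0..<T}|lebesgue. ((1 - q)\<^sup>2 / q) *\<^sub>R (exp (- r * s) *\<^sub>R B s) - (1 - q) *\<^sub>R (exp (- r * s) *\<^sub>R A s))"
    by (intro set_lebesgue_integral_cong allI impI eq) auto
  also have "\<dots> = ((1 - q)\<^sup>2 / q) *\<^sub>R (LINT t|mu r. level T t *\<^sub>R x t) - (1 - q) *\<^sub>R integral\<^sup>L (mu r) x"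
    unfolding set_integral_diff(2)[OF AB] set_integral_scaleR_right A(2) B(2) by (rule refl)
  finally have I: "(LINT s:{0..T}|lebesgue. exp (- r * s) *\<^sub>R (avg_tilde r T x s - avg r T x s)) = \<dots>" .
  have "(LINT t|mu r. drift r T t *\<^sub>R x t) = (LINT t|mu r. T *\<^sub>R (level T t *\<^sub>R x t) - (T * (q / (1 - q))) *\<^sub>R x t)"
    by (intro Bochner_Integration.integral_cong) (simp_all add: drift_def q_def algebra_simps)
  also have "\<dots> = T *\<^sub>R (LINT t|mu r. level T t *\<^sub>R x t) - (T * (q / (1 - q))) *\<^sub>R integral\<^sup>L (mu r) x"
    using xi lxi
    by (subst Bochner_Integration.integral_diff)
      (simp_all only: integral_scaleR_right integrable_scaleR_right simp_thms)
  also have "\<dots> = (T * q / (1 - q)\<^sup>2) *\<^sub>R (((1 - q)\<^sup>2 / q) *\<^sub>R (LINT t|mu r. level T t *\<^sub>R x t) - (1 - q) *\<^sub>R integral\<^sup>L (mu r) x)"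
  proof -
    have "T * q / p\<^sup>2 * (p\<^sup>2 / q) = T" "T * q / p\<^sup>2 * p = T * (q / p)" if "p \<noteq> 0" for p
      using that q by (simp_all add: power2_eq_square)
    from this[OF q(2)] show ?thesis by (simp add: scaleR_diff_right)
  qed
  finally show "(LINT t|mu r. drift r T t *\<^sub>R x t) = (T * exp (- r * T) / (1 - exp (- r * T))\<^sup>2) *\<^sub>R
      (LINT s:{0..T}|lebesgue. exp (- r * s) *\<^sub>R (avg_tilde r T x s - avg r T x s))"
    unfolding I unfolding q_def .
qed

end

section \<open>Density of continuous periodic functions\<close>

lemma L2_norm_nonneg: "L2_norm r f \<ge> 0"
  by (simp add: L2_norm_def)

lemma L2_norm_triangle:
  assumes "f \<in> L2 r" "g \<in> L2 r"
  shows "L2_norm r (\<lambda>t. f t + g t) \<le> L2_norm r f + L2_norm r g"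
proof -
  have sq: "(L2_norm r h)\<^sup>2 = (LINT t|mu r. (norm (h t))\<^sup>2)" for h :: "real \<Rightarrow> real ^ 'a"
    by (simp add: L2_norm_def)
  have "(L2_norm r (\<lambda>t. f t + g t))\<^sup>2 \<le> (L2_norm r f + L2_norm r g)\<^sup>2"
    using L2_Cauchy_Schwarz[OF assms] unfolding sq L2_add(2)[OF assms]
    by (simp add: power2_sum sq)
  then show ?thesis by (rule power2_le_imp_le) (simp add: L2_norm_nonneg)
qed

lemma L2_norm_dominated_convergence:
  assumes m: "f \<in> borel_measurable (mu r)" "\<And>n. h n \<in> borel_measurable (mu r)"
    and w: "integrable (mu r) w" "\<And>n. AE t in mu r. (norm (f t - h n t))\<^sup>2 \<le> w t"
    and lim: "AE t in mu r. (\<lambda>n. h n t) \<longlonglongrightarrow> f t"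
  shows "(\<lambda>n. L2_norm r (\<lambda>t. f t - h n t)) \<longlonglongrightarrow> 0"
proof -
  note [measurable] = m
  have "(\<lambda>n. LINT t|mu r. (norm (f t - h n t))\<^sup>2) \<longlonglongrightarrow> (LINT t|mu r. 0)"
  proof (rule integral_dominated_convergence[OF _ _ w(1)])
    show "AE t in mu r. (\<lambda>n. (norm (f t - h n t))\<^sup>2) \<longlonglongrightarrow> 0"
      using lim
    proof eventually_elim
      case (elim t)
      have "(\<lambda>n. (norm (f t - h n t))\<^sup>2) \<longlonglongrightarrow> (norm (f t - f t))\<^sup>2"
        by (intro tendsto_intros elim)
      then show ?case by simp
    qed
    show "AE t in mu r. norm ((norm (f t - h n t))\<^sup>2) \<le> w t" for n using w(2)[of n] by simp
  qed measurable
  then have "(\<lambda>n. sqrt (LINT t|mu r. (norm (f t - h n t))\<^sup>2)) \<longlonglongrightarrow> sqrt 0"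
    by (intro tendsto_real_sqrt) simp
  then show ?thesis by (simp add: L2_norm_def)
qed

section \<open>Continuous periodic approximants and the period part\<close>

context
  fixes T :: real
  assumes T: "T > 0"
begin

lemma periodic_eq_fundamental:
  assumes "\<And>t. t \<ge> 0 \<Longrightarrow> f (t + T) = f t" "t \<ge> 0"
  shows "f (t - level T t * T) = f t"
proof -
  define n where "n = nat \<lfloor>t / T\<rfloor>"
  have n: "level T t = real n" using level_bounds(1)[OF T assms(2)] by (simp add: n_def level_def)
  have "f ((t - level T t * T) + real n * T) = f (t - level T t * T)"
    using level_bounds(3)[OF T, of t] by (intro periodic_shift[of T f, OF T assms(1)])
  then show ?thesis using n by simp
qed

lemma continuous_at_period_part:
  assumes "t / T \<notin> \<int>"
  shows "isCont (\<lambda>t. t - level T t * T) t"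
proof -
  have "isCont (\<lambda>x. real_of_int \<lfloor>x\<rfloor>) (t / T)"
    using continuous_floor[OF assms] by (simp add: o_def)
  then have "isCont (\<lambda>t. real_of_int \<lfloor>t / T\<rfloor>) t"
    using isCont_o2[where f = "\<lambda>t. t / T" and a = t and g = "\<lambda>x. real_of_int \<lfloor>x\<rfloor>"] T by simp
  then show ?thesis unfolding level_def by (intro continuous_intros)
qed

text \<open>The factor \<open>min 1 (n * \<bar>sin (pi * t / T)\<bar>)\<close> vanishes at the multiples of \<open>T\<close>,
  which removes the jump of the periodic extension there.\<close>

lemma cutoff_periodic_cont:
  fixes g :: "real \<Rightarrow> real ^ 'n"
  assumes g: "continuous_on UNIV g" and B: "\<And>t. norm (g t) \<le> B"
  shows "(\<lambda>t. min 1 (c * \<bar>sin (t / T * pi)\<bar>) *\<^sub>R g (t - level T t * T)) \<in> periodic_cont T"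
proof -
  define \<psi> where "\<psi> = (\<lambda>t. min 1 (c * \<bar>sin (t / T * pi)\<bar>))"
  have \<psi>c: "isCont \<psi> t" for t
    unfolding \<psi>_def using T by (intro continuous_intros) auto
  have per: "\<psi> (t + T) *\<^sub>R g (t + T - level T (t + T) * T) = \<psi> t *\<^sub>R g (t - level T t * T)" for t
  proof -
    have e: "(t + T) / T = t / T + 1" using T by (simp add: field_simps)
    then have "level T (t + T) = level T t + 1" by (simp add: level_def)
    \<comment> \<open>A shift by one period only changes the sign of the sine, and the absolute
      value removes that sign.\<close>
    moreover have "(t + T) / T * pi = t / T * pi + pi" unfolding e by (simp add: algebra_simps)
    then have "\<psi> (t + T) = \<psi> t" by (simp add: \<psi>_def)
    ultimately show ?thesis by (simp add: algebra_simps)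
  qed
  have "isCont (\<lambda>t. \<psi> t *\<^sub>R g (t - level T t * T)) t" for t
  proof (cases "t / T \<in> \<int>")
    case False
    have "isCont g (t - level T t * T)" using g by (simp add: continuous_on_eq_continuous_at)
    then have "isCont (\<lambda>t. g (t - level T t * T)) t"
      by (rule isCont_o2[OF continuous_at_period_part[OF False]])
    with \<psi>c[of t] show ?thesis by (rule continuous_scaleR)
  next
    case True
    then have 0: "\<psi> t = 0" using sin_times_pi_eq_0[of "t / T"] by (simp add: \<psi>_def)
    have "(\<psi> \<longlongrightarrow> 0) (at t)" using \<psi>c[of t] 0 by (simp add: isCont_def)
    then have lim: "((\<lambda>u. \<bar>\<psi> u\<bar> * B) \<longlongrightarrow> 0) (at t)"
      by (rule tendsto_mult_left_zero[OF tendsto_rabs_zero])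
    have "\<forall>\<^sub>F u in at t. norm (\<psi> u *\<^sub>R g (u - level T u * T)) \<le> \<bar>\<psi> u\<bar> * B"
      using B by (simp add: mult_left_mono)
    then have "((\<lambda>u. \<psi> u *\<^sub>R g (u - level T u * T)) \<longlongrightarrow> 0) (at t)"
      using lim by (rule Lim_null_comparison)
    then show ?thesis using 0 by (simp add: isCont_def)
  qed
  then have "continuous_on {0..} (\<lambda>t. \<psi> t *\<^sub>R g (t - level T t * T))"
    by (intro continuous_at_imp_continuous_on) auto
  with per show ?thesis unfolding periodic_cont_def \<psi>_def by simp
qed

text \<open>The period part of t lies in \<open>N\<close> only if t lies in a translate of
  \<open>N\<close> by an integer multiple of T, and countably many translates of a null set are
  null. Exceptional sets on one period thus stay negligible on the half-line.\<close>

lemma AE_mu_period_part: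
  assumes N: "negligible N"
  shows "AE t in mu r. t / T \<notin> \<int> \<and> t - level T t * T \<notin> N"
proof -
  have "negligible (\<Union>k::int. (+) (of_int k * T) ` N)"
  proof (rule negligible_countable_Union)
    show "negligible S" if "S \<in> range (\<lambda>k::int. (+) (of_int k * T) ` N)" for S
      using that negligible_translation[OF N] by blast
  qed simp
  then have 1: "AE t in lebesgue. t \<notin> (\<Union>k::int. (+) (of_int k * T) ` N)"
    unfolding negligible_iff_null_sets by (rule AE_not_in)
  have 2: "AE t in lebesgue. t \<notin> range (\<lambda>k::int. of_int k * T)"
    by (intro AE_not_in null_sets_completionI countable_imp_null_set_lborel) simp
  from 1 2 have "AE t in lebesgue. t / T \<notin> \<int> \<and> t - level T t * T \<notin> N"
  proof eventually_elim
    case (elim t)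
    have "t / T \<notin> \<int>"
    proof
      assume "t / T \<in> \<int>"
      then obtain k where "t / T = of_int k" by (auto elim: Ints_cases)
      then have "t = of_int k * T" using T by (simp add: field_simps)
      with elim show False by blast
    qed
    moreover have "t - level T t * T \<notin> N"
    proof
      assume "t - level T t * T \<in> N"
      then have "t \<in> (+) (of_int \<lfloor>t / T\<rfloor> * T) ` N"
        by (intro image_eqI[of _ _ "t - level T t * T"]) (simp_all add: level_def)
      with elim show False by blast
    qed
    ultimately show ?case ..
  qed
  then show ?thesis unfolding AE_mu_iff by eventually_elim simp
qed

end

section \<open>Approximation in the norm of \<open>L2 r\<close>\<close>

context
  fixes r T :: real
  assumes r: "r > 0" and T: "T > 0"
begin

lemma periodic_cont_L2:
  assumes g: "g \<in> periodic_cont T"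
  shows "g \<in> L2 r"
proof -
  have c: "continuous_on {0..} g" and per: "\<And>t. t \<ge> 0 \<Longrightarrow> g (t + T) = g t"
    using g by (auto simp: periodic_cont_def)
  have "compact (g ` {0..T})"
    by (intro compact_continuous_image continuous_on_subset[OF c]) auto
  then obtain B where B: "\<And>t. t \<in> {0..T} \<Longrightarrow> norm (g t) \<le> B"
    using compact_imp_bounded[of "g ` {0..T}"] unfolding bounded_iff by blast
  have "norm (g t) \<le> B" if "t \<ge> 0" for t
    using B[of "t - level T t * T"] level_bounds(3,4)[OF T, of t] periodic_eq_fundamental[OF T, of g t, OF per that]
    by simp
  then show ?thesis using measurable_mu_continuous_on[OF c] by (intro L2_bounded[OF r]) auto
qed

text \<open>The closure is defined by approximation with \<open>periodic_cont\<close>, so its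
  closedness has to be proved. It allows approximating in two stages: truncation to bounded
  functions, then smoothing of these.\<close>

lemma periodic_closure_closed:
  assumes f: "f \<in> L2 r" and h: "\<And>n. h n \<in> periodic_closure r T"
    and lim: "(\<lambda>n. L2_norm r (\<lambda>t. f t - h n t)) \<longlonglongrightarrow> 0"
  shows "f \<in> periodic_closure r T"
  unfolding periodic_closure_def
proof (intro CollectI conjI allI impI f)
  fix e :: real assume e: "e > 0"
  obtain n where n: "L2_norm r (\<lambda>t. f t - h n t) < e / 2"
    using order_tendstoD(2)[OF lim, of "e / 2"] e by (auto simp: eventually_sequentially)
  obtain q where q: "q \<in> periodic_cont T" "L2_norm r (\<lambda>t. h n t - q t) < e / 2"
    using h[of n] e unfolding periodic_closure_def by (auto dest!: spec[of _ "e / 2"])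
  have hn: "h n \<in> L2 r" using h[of n] by (simp add: periodic_closure_def)
  have "L2_norm r (\<lambda>t. (f t - h n t) + (h n t - q t)) \<le> L2_norm r (\<lambda>t. f t - h n t) + L2_norm r (\<lambda>t. h n t - q t)"
    by (intro L2_norm_triangle L2_diff f hn periodic_cont_L2 q)
  then have "L2_norm r (\<lambda>t. f t - q t) < e" using n q by simp
  with q show "\<exists>q\<in>periodic_cont T. L2_norm r (\<lambda>t. f t - q t) < e" by blast
qed

text \<open>A Lebesgue-measurable function is an almost everywhere limit of continuous functions.
  Clipping their values gives a uniform bound, the sine cutoff repairs continuity across periods,
  and dominated convergence applies because \<open>mu r\<close> is finite.\<close>

lemma bounded_periodic_in_closure:
  fixes f :: "real \<Rightarrow> real ^ 'n"
  assumes m: "f \<in> borel_measurable (mu r)" and b: "\<And>t. t \<ge> 0 \<Longrightarrow> norm (f t) \<le> B"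
    and per: "\<And>t. t \<ge> 0 \<Longrightarrow> f (t + T) = f t"
  shows "f \<in> periodic_closure r T"
proof -
  define C where "C = max B 1"
  have C: "C > 0" and bC: "\<And>t. t \<ge> 0 \<Longrightarrow> norm (f t) \<le> C" using b by (force simp: C_def)+
  have "f \<in> borel_measurable (lebesgue_on {0..})" using m unfolding mu_def by simp
  then have "f measurable_on {0..}" by (subst measurable_on_iff_borel_measurable) auto
  then obtain N g where N: "negligible N" and g: "\<And>n. continuous_on UNIV (g n)"
    and lim: "\<And>t. t \<notin> N \<Longrightarrow> (\<lambda>n. g n t) \<longlonglongrightarrow> (if t \<in> {0..} then f t else 0)"
    unfolding measurable_on_def by metis
  \<comment> \<open>The radial retraction onto the ball of radius C: continuous, bounded by C, and
    the identity on the values taken by \<open>f\<close> at nonnegative times.\<close>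
  define clip :: "real ^ 'n \<Rightarrow> real ^ 'n" where "clip = (\<lambda>v. (C / max C (norm v)) *\<^sub>R v)"
  have clip_cont: "continuous_on UNIV clip"
    unfolding clip_def using C by (intro continuous_intros) (auto simp: max_def)
  have clip_le: "norm (clip v) \<le> C" for v
    using C by (auto simp: clip_def max_def field_simps)
  have clip_id: "clip v = v" if "norm v \<le> C" for v
    using that C by (simp add: clip_def max_def)
  \<comment> \<open>The approximants \<open>g n\<close> are sampled only at the period part of t,
    which imposes periodicity although \<open>g n\<close> itself need not be periodic.\<close>
  define h where "h = (\<lambda>n t. min 1 (real n * \<bar>sin (t / T * pi)\<bar>) *\<^sub>R clip (g n (t - level T t * T)))"
  have "continuous_on UNIV (\<lambda>t. clip (g n t))" for n
    using continuous_on_compose2[OF clip_cont g[of n]] by simp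
  then have hp: "h n \<in> periodic_cont T" for n
    unfolding h_def by (rule cutoff_periodic_cont[OF T _ clip_le])
  have h_le: "norm (h n t) \<le> C" for n t
  proof -
    have "norm (h n t) \<le> 1 * C"
      unfolding h_def norm_scaleR by (intro mult_mono clip_le) auto
    then show ?thesis by simp
  qed
  have fL: "f \<in> L2 r" by (rule L2_bounded[OF r m b])
  have "(\<lambda>n. L2_norm r (\<lambda>t. f t - h n t)) \<longlonglongrightarrow> 0"
  proof (rule L2_norm_dominated_convergence[OF m])
    show "h n \<in> borel_measurable (mu r)" for n using L2_D(1)[OF periodic_cont_L2[OF hp]] .
    show "integrable (mu r) (\<lambda>_. (C + C)\<^sup>2)" by (rule integrable_mu_const[OF r])
    have "(norm (f t - h n t))\<^sup>2 \<le> (C + C)\<^sup>2" if "t \<ge> 0" for n t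
      using norm_triangle_ineq4[of "f t" "h n t"] bC[OF that] h_le[of n t]
      by (intro power_mono) auto
    then show "AE t in mu r. (norm (f t - h n t))\<^sup>2 \<le> (C + C)\<^sup>2" for n
      unfolding AE_mu_iff by simp
    show "AE t in mu r. (\<lambda>n. h n t) \<longlonglongrightarrow> f t"
      using AE_mu_period_part[OF T N] unfolding AE_mu_iff
    proof eventually_elim
      case (elim t)
      show ?case
      proof
        assume t: "t \<ge> 0"
        define s where "s = t - level T t * T"
        have s: "s \<ge> 0" "s \<notin> N" using level_bounds(3)[OF T, of t] elim t by (simp_all add: s_def)
        have fs: "f s = f t" unfolding s_def by (rule periodic_eq_fundamental[OF T, of f t, OF per t])
        have "(\<lambda>n. g n s) \<longlonglongrightarrow> f s" using lim[OF s(2)] s by simp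
        moreover have "isCont clip (f s)" using clip_cont by (simp add: continuous_on_eq_continuous_at)
        ultimately have "(\<lambda>n. clip (g n s)) \<longlonglongrightarrow> clip (f s)" by (rule isCont_tendsto_compose[rotated])
        then have 1: "(\<lambda>n. clip (g n s)) \<longlonglongrightarrow> f t" using clip_id bC[OF s(1)] fs by simp
        define a where "a = \<bar>sin (t / T * pi)\<bar>"
        have a: "a > 0" using elim t sin_times_pi_eq_0[of "t / T"] by (simp add: a_def)
        \<comment> \<open>Off the multiples of T the sine is nonzero, so the cutoff equals 1 from
          some index on.\<close>
        have "eventually (\<lambda>n. real n > 1 / a) sequentially"
          using filterlim_real_sequentially by (simp add: filterlim_at_top_dense)
        then have "eventually (\<lambda>n. min 1 (real n * a) = 1) sequentially"
          by eventually_elim (use a in \<open>simp add: field_simps\<close>)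
        then have "(\<lambda>n. min 1 (real n * a)) \<longlonglongrightarrow> 1" by (rule tendsto_eventually)
        from tendsto_scaleR[OF this 1] show "(\<lambda>n. h n t) \<longlonglongrightarrow> f t"
          by (simp add: h_def a_def s_def)
      qed
    qed
  qed
  moreover have "h n \<in> periodic_closure r T" for n
    using hp[of n] periodic_cont_L2[OF hp[of n]] unfolding periodic_closure_def
    by (auto intro!: bexI[of _ "h n"] simp: L2_norm_def)
  ultimately show ?thesis by (intro periodic_closure_closed[OF fL])
qed

text \<open>Replacing \<open>f\<close> by 0 where its norm exceeds n keeps periodicity, since the
  condition depends on the value alone, and leaves an error dominated by \<open>f\<close>
  itself.\<close>

lemma periodic_L2_in_closure:
  fixes f :: "real \<Rightarrow> real ^ 'n"
  assumes f: "f \<in> L2 r" and per: "\<And>t. t \<ge> 0 \<Longrightarrow> f (t + T) = f t"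
  shows "f \<in> periodic_closure r T"
proof -
  note [measurable] = L2_D(1)[OF f]
  define h where "h = (\<lambda>n t. if norm (f t) \<le> real n then f t else 0)"
  have hm [measurable]: "h n \<in> borel_measurable (mu r)" for n unfolding h_def by measurable
  have "h n \<in> periodic_closure r T" for n
    by (rule bounded_periodic_in_closure[OF hm, of _ "real n"]) (auto simp: h_def per)
  moreover have "(\<lambda>n. L2_norm r (\<lambda>t. f t - h n t)) \<longlonglongrightarrow> 0"
  proof (rule L2_norm_dominated_convergence[OF L2_D(1)[OF f] hm L2_D(2)[OF f]])
    show "AE t in mu r. (norm (f t - h n t))\<^sup>2 \<le> (norm (f t))\<^sup>2" for n by (simp add: h_def)
    have "(\<lambda>n. h n t) \<longlonglongrightarrow> f t" for t
    proof (rule tendsto_eventually)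
      have "eventually (\<lambda>n. real n > norm (f t)) sequentially"
        using filterlim_real_sequentially by (simp add: filterlim_at_top_dense)
      then show "eventually (\<lambda>n. h n t = f t) sequentially"
        by eventually_elim (simp add: h_def)
    qed
    then show "AE t in mu r. (\<lambda>n. h n t) \<longlonglongrightarrow> f t" by simp
  qed
  ultimately show ?thesis by (intro periodic_closure_closed[OF f])
qed

end

section \<open>The orthogonal decomposition\<close>

lemma time_L2:
  assumes r: "r > 0"
  shows "(\<lambda>t. t *\<^sub>R a) \<in> L2 r"
  by (intro L2_scaleR_const integrable_mu_square[OF r] measurable_mu_borel) measurable

lemma energy_eq:
  assumes r: "r > 0" and x: "x \<in> L2 r" and p: "p \<in> L2 r"
  shows "energy r x p a = (LINT t|mu r. (norm (x t - p t - t *\<^sub>R a))\<^sup>2)"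
proof -
  have "(\<lambda>t. x t - p t - t *\<^sub>R a) \<in> L2 r" by (intro L2_diff x p time_L2[OF r])
  from L2_D[OF this] show ?thesis
    unfolding energy_def set_lebesgue_integral_def by (subst integral_mu_eq) auto
qed

context
  fixes r T :: real
  assumes r: "r > 0" and T: "T > 0"
begin

text \<open>Orthogonality passes to the limit by continuity of the inner product, so elements of the
  closure never have to be recognised as periodic.\<close>

lemma orthogonal_periodic_closure:
  assumes G: "G \<in> L2 r" and orth: "\<And>q. q \<in> periodic_cont T \<Longrightarrow> (LINT t|mu r. G t \<bullet> q t) = 0"
    and f: "f \<in> periodic_closure r T"
  shows "(LINT t|mu r. G t \<bullet> f t) = 0"
proof -
  have fL: "f \<in> L2 r" using f by (simp add: periodic_closure_def)
  have "\<bar>LINT t|mu r. G t \<bullet> f t\<bar> \<le> 0 + e" if e: "e > 0" for e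
  proof -
    \<comment> \<open>Adding 1 keeps the denominator positive when \<open>G\<close> has norm
      0.\<close>
    have "e / (L2_norm r G + 1) > 0" using e L2_norm_nonneg[of r G] by simp
    then obtain q where q: "q \<in> periodic_cont T" "L2_norm r (\<lambda>t. f t - q t) < e / (L2_norm r G + 1)"
      using f unfolding periodic_closure_def by blast
    note qL = periodic_cont_L2[OF r T q(1)]
    have "(LINT t|mu r. G t \<bullet> f t) = (LINT t|mu r. G t \<bullet> (f t - q t))"
      using orth[OF q(1)] L2_inner_integrable[OF G fL] L2_inner_integrable[OF G qL]
      by (simp add: inner_diff_right)
    also have "\<bar>\<dots>\<bar> \<le> L2_norm r G * L2_norm r (\<lambda>t. f t - q t)"
      by (intro L2_Cauchy_Schwarz G L2_diff fL qL)
    also have "\<dots> \<le> (L2_norm r G + 1) * (e / (L2_norm r G + 1))"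
      using q(2) L2_norm_nonneg by (intro mult_mono) (auto intro: add_nonneg_nonneg)
    also have "\<dots> = e" using L2_norm_nonneg[of r G] by simp
    finally show ?thesis by simp
  qed
  then have "\<bar>LINT t|mu r. G t \<bullet> f t\<bar> \<le> 0" by (rule field_le_epsilon)
  then show ?thesis by simp
qed

lemma drift_L2: "(\<lambda>t. drift r T t *\<^sub>R a) \<in> L2 r"
  by (intro L2_scaleR_const drift_measurable_mu drift_square_integrable[OF r T])

lemma integrable_drift_inner:
  assumes f: "f \<in> L2 r"
  shows "integrable (mu r) (\<lambda>t. drift r T t * (f t \<bullet> b))"
  using L2_inner_integrable[OF drift_L2 f, of b] by (simp add: inner_commute)

lemma drift_orthogonal_inner:
  assumes g: "g \<in> L2 r" and per: "\<And>t. t \<ge> 0 \<Longrightarrow> g (t + T) = g t"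
  shows "(LINT t|mu r. drift r T t * (g t \<bullet> b)) = 0"
proof (rule drift_orthogonal[OF r T])
  note [measurable] = L2_D(1)[OF g]
  show "(\<lambda>t. g t \<bullet> b) \<in> borel_measurable (mu r)" by measurable
  show "integrable (mu r) (\<lambda>t. (g t \<bullet> b)\<^sup>2)"
  proof (rule Bochner_Integration.integrable_bound)
    show "integrable (mu r) (\<lambda>t. (norm (g t))\<^sup>2 * (norm b)\<^sup>2)" using L2_D(2)[OF g] by simp
    have "(g t \<bullet> b)\<^sup>2 \<le> (norm (g t))\<^sup>2 * (norm b)\<^sup>2" for t
      using Cauchy_Schwarz_ineq[of "g t" b] by (simp add: power2_norm_eq_inner)
    then show "AE t in mu r. norm ((g t \<bullet> b)\<^sup>2) \<le> norm ((norm (g t))\<^sup>2 * (norm b)\<^sup>2)" by simp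
  qed measurable
  show "g (t + T) \<bullet> b = g t \<bullet> b" if "t \<ge> 0" for t using per[OF that] by simp
qed

text \<open>The difference is the sawtooth t - \<open>level T t\<close> * T raised by the constant T
  q / (1 - q), hence bounded and T-periodic.\<close>

lemma time_minus_drift:
  shows "0 \<le> t \<Longrightarrow> \<bar>t - drift r T t\<bar> \<le> T + T * exp (- r * T) / (1 - exp (- r * T))"
    and "(t + T) - drift r T (t + T) = t - drift r T t"
proof -
  have "\<bar>T * exp (- r * T) / (1 - exp (- r * T))\<bar> = T * exp (- r * T) / (1 - exp (- r * T))"
    using q_bounds[OF r T] T by (intro abs_of_nonneg divide_nonneg_nonneg) auto
  moreover have eq: "t - drift r T t = (t - level T t * T) + T * exp (- r * T) / (1 - exp (- r * T))" for t
    by (simp add: drift_def algebra_simps)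
  moreover have "\<bar>t - level T t * T\<bar> \<le> T" using level_bounds(3,4)[OF T, of t] by simp
  ultimately show "\<bar>t - drift r T t\<bar> \<le> T + T * exp (- r * T) / (1 - exp (- r * T))"
    using abs_triangle_ineq[of "t - level T t * T" "T * exp (- r * T) / (1 - exp (- r * T))"]
    unfolding eq[of t] by linarith
  have "(t + T) / T = t / T + 1" using T by (simp add: field_simps)
  then have "level T (t + T) = level T t + 1" by (simp add: level_def)
  then show "(t + T) - drift r T (t + T) = t - drift r T t"
    by (simp add: drift_def algebra_simps)
qed

lemma time_minus_drift_L2: "(\<lambda>t. (t - drift r T t) *\<^sub>R a) \<in> L2 r"
proof (rule L2_bounded[OF r])
  show "(\<lambda>t. (t - drift r T t) *\<^sub>R a) \<in> borel_measurable (mu r)"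
    by (intro measurable_mu_borel) measurable
  show "norm ((t - drift r T t) *\<^sub>R a) \<le> (T + T * exp (- r * T) / (1 - exp (- r * T))) * norm a" if "t \<ge> 0" for t
    using mult_right_mono[OF time_minus_drift(1)[OF that], of "norm a"] by simp
qed

text \<open>Identifies the correction term in the formula for p with the periodic part of the ramp.
  The series are explicit and converge on every fibre, so equality holds pointwise.\<close>

lemma periodic_ext_avg_linear:
  "periodic_ext T (avg r T (\<lambda>u. u *\<^sub>R a)) t = (t - drift r T t) *\<^sub>R a"
proof -
  define q s where "q = exp (- r * T)" and "s = t - level T t * T"
  have q: "1 - q \<noteq> 0" using q_bounds[OF r T] unfolding q_def by linarith
  have "(\<lambda>k. s * exp (- r * real k * T) + T * (exp (- r * real k * T) * real k)) sums
    (s * (1 / (1 - q)) + T * (q / (1 - q)\<^sup>2))"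
    unfolding q_def by (intro sums_add sums_mult sums_q[OF r T] sums_weighted_k[OF r T])
  then have "(\<lambda>k. (s * exp (- r * real k * T) + T * (exp (- r * real k * T) * real k)) *\<^sub>R a) sums
    ((s * (1 / (1 - q)) + T * (q / (1 - q)\<^sup>2)) *\<^sub>R a)"
    by (rule sums_scaleR_left)
  then have "(\<lambda>k. exp (- r * real k * T) *\<^sub>R ((s + real k * T) *\<^sub>R a)) sums
    ((s * (1 / (1 - q)) + T * (q / (1 - q)\<^sup>2)) *\<^sub>R a)"
    by (simp add: algebra_simps)
  then have "avg r T (\<lambda>u. u *\<^sub>R a) s = ((1 - q) * (s * (1 / (1 - q)) + T * (q / (1 - q)\<^sup>2))) *\<^sub>R a"
    by (simp add: avg_def sums_iff q_def)
  also have "(1 - q) * (s * (1 / (1 - q)) + T * (q / (1 - q)\<^sup>2)) = s + T * (q / (1 - q))"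
  proof -
    have "p * (s * (1 / p) + T * (q / p\<^sup>2)) = s + T * (q / p)" if "p \<noteq> 0" for p
      using that by (simp add: field_simps power2_eq_square)
    from this[OF q] show ?thesis .
  qed
  also have "s + T * (q / (1 - q)) = t - drift r T t"
    by (simp add: s_def q_def drift_def algebra_simps)
  finally show ?thesis by (simp add: periodic_ext_def s_def level_def)
qed

text \<open>Time is the drift plus a bounded periodic function, and the latter is orthogonal to the
  drift.\<close>

lemma integral_drift_time: "(LINT t|mu r. drift r T t * (t * c)) = (LINT t|mu r. (drift r T t)\<^sup>2) * c"
proof -
  define w where "w = (\<lambda>t. t - drift r T t)"
  have wm: "w \<in> borel_measurable (mu r)"
    unfolding w_def by (intro measurable_mu_borel) measurable
  have wi: "integrable (mu r) (\<lambda>t. (w t)\<^sup>2)"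
  proof (rule integrable_mu_bounded[OF r])
    show "(\<lambda>t. (w t)\<^sup>2) \<in> borel_measurable (mu r)" using wm by measurable
    show "norm ((w t)\<^sup>2) \<le> (T + T * exp (- r * T) / (1 - exp (- r * T)))\<^sup>2" if "t \<ge> 0" for t
      using power_mono[OF time_minus_drift(1)[OF that], of 2] by (simp add: w_def)
  qed
  have "(LINT t|mu r. drift r T t * w t) = 0"
    by (rule drift_orthogonal[OF r T wm wi]) (simp add: w_def time_minus_drift(2))
  moreover have "integrable (mu r) (\<lambda>t. drift r T t * w t)"
    by (intro integrable_mu_mult_of_squares drift_measurable_mu drift_square_integrable[OF r T] wm wi)
  moreover have "drift r T t * (t * c) = (drift r T t)\<^sup>2 * c + drift r T t * w t * c" for t
    by (simp add: w_def power2_eq_square algebra_simps)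
  ultimately show ?thesis using drift_square_integrable[OF r T] by simp
qed

end

text \<open>The candidate is written down explicitly, so existence requires no abstract projection
  theorem; the formulas for an arbitrary solution follow by comparing it with the candidate.\<close>

theorem theorem3p6:
  fixes r T :: real and x :: "real \<Rightarrow> real ^ 'n"
  assumes "r > 0" and "T > 0" and "x \<in> L2 r"
  shows
    "(\<exists>p a. is_solution r T x p a \<and>
        (\<forall>q b. is_solution r T x q b \<longrightarrow> (AE t in mu r. q t = p t) \<and> b = a)) \<and>
     (AE s in lebesgue_on {0..T}.
        summable (\<lambda>k. exp (- r * real k * T) *\<^sub>R x (s + real k * T)) \<and>
        summable (\<lambda>k. (real k * exp (- r * real k * T)) *\<^sub>R x (s + real k * T))) \<and>
     set_integrable lebesgue {0..T}
       (\<lambda>s. exp (- r * s) *\<^sub>R (avg_tilde r T x s - avg r T x s)) \<and>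
     (\<forall>p a. is_solution r T x p a \<longrightarrow>
        a = (r / T) *\<^sub>R
              (LINT s:{0..T}|lebesgue. exp (- r * s) *\<^sub>R (avg_tilde r T x s - avg r T x s)) \<and>
        (AE t in mu r. p t = periodic_ext T (avg r T x) t
                              - periodic_ext T (avg r T (\<lambda>u. u *\<^sub>R a)) t))"
proof -
  note r = assms(1) and T = assms(2) and x = assms(3)
  define d where "d = drift r T"
  define H where "H = (LINT t|mu r. (d t)\<^sup>2)"
  define I where "I = (LINT s:{0..T}|lebesgue. exp (- r * s) *\<^sub>R (avg_tilde r T x s - avg r T x s))"
  define \<alpha> where "\<alpha> = (r / T) *\<^sub>R I"
  define Px where "Px = periodic_ext T (avg r T x)"
  \<comment> \<open>This is the projection of x minus the ramp t \<alpha>, since t - d t is the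
    periodic part of t.\<close>
  define ph where "ph = (\<lambda>t. Px t - (t - d t) *\<^sub>R \<alpha>)"
  define R where "R = (\<lambda>t. x t - Px t - d t *\<^sub>R \<alpha>)"
  have PxL: "Px \<in> L2 r" unfolding Px_def by (rule L2_avg[OF r T x])
  have Px_per: "Px (t + T) = Px t" for t unfolding Px_def by (rule periodic_ext_periodic[OF T])
  have RL: "R \<in> L2 r" unfolding R_def d_def by (intro L2_diff x PxL drift_L2[OF r T])
  have phL: "ph \<in> L2 r" unfolding ph_def d_def by (intro L2_diff PxL time_minus_drift_L2[OF r T])
  have ph_per: "ph (t + T) = ph t" for t
    using time_minus_drift(2)[OF r T, of t] by (simp add: ph_def d_def Px_per)
  have phC: "ph \<in> periodic_closure r T" by (rule periodic_L2_in_closure[OF r T phL ph_per])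
  have H: "H = T\<^sup>2 * exp (- r * T) / ((1 - exp (- r * T))\<^sup>2 * r)"
    unfolding H_def d_def by (rule integral_drift_square[OF r T])
  have "1 - exp (- r * T) \<noteq> 0" using q_bounds[OF r T] by linarith
  then have Hpos: "H > 0" unfolding H using r T by (intro divide_pos_pos mult_pos_pos) auto
  \<comment> \<open>Here the factor r / T is accounted for: H r / T = T q / (1 - q)^2, the
    coefficient in \<open>integral_drift\<close>.\<close>
  have dx: "(LINT t|mu r. d t *\<^sub>R x t) = H *\<^sub>R \<alpha>"
    unfolding d_def integral_drift(2)[OF r T x] \<alpha>_def I_def[symmetric] H
    using r T by (simp add: power2_eq_square)
  have R_per: "(LINT t|mu r. R t \<bullet> g t) = 0"
    if g: "g \<in> L2 r" and per: "\<And>t. t \<ge> 0 \<Longrightarrow> g (t + T) = g t" for g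
  proof -
    have "R t \<bullet> g t = x t \<bullet> g t - Px t \<bullet> g t - d t * (g t \<bullet> \<alpha>)" for t
      by (simp add: R_def inner_diff_left inner_commute[of \<alpha>])
    then have "(LINT t|mu r. R t \<bullet> g t) =
      (LINT t|mu r. x t \<bullet> g t) - (LINT t|mu r. Px t \<bullet> g t) - (LINT t|mu r. d t * (g t \<bullet> \<alpha>))"
      using L2_inner_integrable[OF x g] L2_inner_integrable[OF PxL g]
        integrable_drift_inner[OF r T g, of \<alpha>] by (simp add: d_def)
    also have "\<dots> = 0"
      using integral_inner_avg[OF r T x g per] drift_orthogonal_inner[OF r T g per]
      by (simp add: Px_def d_def)
    finally show ?thesis .
  qed
  have R_closure: "(LINT t|mu r. R t \<bullet> f t) = 0" if "f \<in> periodic_closure r T" for f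
    by (rule orthogonal_periodic_closure[OF r T RL R_per that])
      (auto simp: periodic_cont_def intro: periodic_cont_L2[OF r T])
  \<comment> \<open>The ramp is split into its periodic part, covered by \<open>R_per\<close>, and
    its drift part, against which \<open>R\<close> vanishes by the choice of \<alpha>.\<close>
  have R_time: "(LINT t|mu r. R t \<bullet> (t *\<^sub>R b)) = 0" for b
  proof -
    have dRb: "(LINT t|mu r. d t * (R t \<bullet> b)) = 0"
    proof -
      have "integrable (mu r) (\<lambda>t. d t *\<^sub>R x t)"
        unfolding d_def by (rule L2_scaleR_integrable[OF drift_measurable_mu drift_square_integrable[OF r T] x])
      then have "(LINT t|mu r. (d t *\<^sub>R x t) \<bullet> b) = (LINT t|mu r. d t *\<^sub>R x t) \<bullet> b"
        by (rule integral_inner_left)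
      then have "(LINT t|mu r. d t * (x t \<bullet> b)) = H * (\<alpha> \<bullet> b)" unfolding dx by simp
      moreover have "(LINT t|mu r. d t * (Px t \<bullet> b)) = 0"
        unfolding d_def by (rule drift_orthogonal_inner[OF r T PxL Px_per])
      moreover have "d t * (R t \<bullet> b) = d t * (x t \<bullet> b) - d t * (Px t \<bullet> b) - (d t)\<^sup>2 * (\<alpha> \<bullet> b)" for t
        by (simp add: R_def inner_diff_left algebra_simps power2_eq_square)
      ultimately show ?thesis
        using integrable_drift_inner[OF r T x, of b] integrable_drift_inner[OF r T PxL, of b]
          drift_square_integrable[OF r T] by (simp add: d_def H_def)
    qed
    have "(LINT t|mu r. R t \<bullet> ((t - d t) *\<^sub>R b)) = 0"
      unfolding d_def by (intro R_per time_minus_drift_L2[OF r T]) (simp add: time_minus_drift(2)[OF r T])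
    moreover have "R t \<bullet> (t *\<^sub>R b) = R t \<bullet> ((t - d t) *\<^sub>R b) + d t * (R t \<bullet> b)" for t
      by (simp add: algebra_simps)
    ultimately show ?thesis
      using dRb L2_inner_integrable[OF RL time_minus_drift_L2[OF r T, of b]] integrable_drift_inner[OF r T RL, of b]
      by (simp add: d_def)
  qed
  \<comment> \<open>The gap between candidate and competitor, so that the competitor's error is R +
    D. It combines a difference of closure elements with a ramp, both orthogonal to R.\<close>
  define D where "D = (\<lambda>q b t. (ph t - q t) + t *\<^sub>R (\<alpha> - b))"
  have DL: "D q b \<in> L2 r" if "q \<in> L2 r" for q b
    unfolding D_def by (intro L2_add(1) L2_diff phL that time_L2[OF r])
  have energy_split: "energy r x q b = energy r x ph \<alpha> + (LINT t|mu r. (norm (D q b t))\<^sup>2)"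
    if q: "q \<in> periodic_closure r T" for q b
  proof -
    have qL: "q \<in> L2 r" using q by (simp add: periodic_closure_def)
    have 1: "x t - ph t - t *\<^sub>R \<alpha> = R t" for t
      by (simp add: R_def ph_def algebra_simps)
    have 2: "x t - q t - t *\<^sub>R b = R t + D q b t" for t
      by (simp add: D_def R_def ph_def algebra_simps)
    have "R t \<bullet> D q b t = R t \<bullet> ph t - R t \<bullet> q t + R t \<bullet> (t *\<^sub>R (\<alpha> - b))" for t
      by (simp add: D_def inner_add_right inner_diff_right)
    then have "(LINT t|mu r. R t \<bullet> D q b t) = 0"
      using R_closure[OF phC] R_closure[OF q] R_time[of "\<alpha> - b"]
        L2_inner_integrable[OF RL phL] L2_inner_integrable[OF RL qL]
        L2_inner_integrable[OF RL time_L2[OF r, of "\<alpha> - b"]] by simp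
    then show ?thesis
      unfolding energy_eq[OF r x qL] energy_eq[OF r x phL] 1 2 L2_add(2)[OF RL DL[OF qL]] by simp
  qed
  have sol: "is_solution r T x ph \<alpha>"
    unfolding is_solution_def
  proof (intro conjI ballI allI phC)
    fix q :: "real \<Rightarrow> real ^ 'n" and b assume "q \<in> periodic_closure r T"
    from energy_split[OF this, of b] show "energy r x ph \<alpha> \<le> energy r x q b" by simp
  qed
  have uniq: "(AE t in mu r. q t = ph t) \<and> b = \<alpha>" if "is_solution r T x q b" for q b
  proof -
    have q: "q \<in> periodic_closure r T" and le: "energy r x q b \<le> energy r x ph \<alpha>"
      using that phC by (auto simp: is_solution_def)
    have qL: "q \<in> L2 r" using q by (simp add: periodic_closure_def)
    have "(LINT t|mu r. (norm (D q b t))\<^sup>2) = 0"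
      using le energy_split[OF q, of b] by (intro antisym) auto
    then have D0: "AE t in mu r. D q b t = 0"
      using integral_nonneg_eq_0_iff_AE[OF L2_D(2)[OF DL[OF qL]], of b] by simp
    define c where "c = \<alpha> - b"
    \<comment> \<open>Vanishing of D as a sum must be split into its two parts. Pairing with the
      drift removes the periodic part and leaves H times the squared norm of \<alpha> - b.\<close>
    have "(LINT t|mu r. d t * (D q b t \<bullet> c)) = (LINT t|mu r. 0)"
    proof (rule integral_cong_AE)
      show "(\<lambda>t. d t * (D q b t \<bullet> c)) \<in> borel_measurable (mu r)"
        using integrable_drift_inner[OF r T DL[OF qL]] unfolding d_def by (rule borel_measurable_integrable)
      show "AE t in mu r. d t * (D q b t \<bullet> c) = 0" using D0 by eventually_elim simp
    qed simp
    moreover have "d t * (D q b t \<bullet> c) = d t * (ph t \<bullet> c) - d t * (q t \<bullet> c) + d t * (t * (c \<bullet> c))" for t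
      by (simp add: D_def c_def inner_add_left inner_diff_left algebra_simps)
    moreover have "(LINT t|mu r. d t * (ph t \<bullet> c)) = 0"
      unfolding d_def by (rule drift_orthogonal_inner[OF r T phL ph_per])
    \<comment> \<open>The competitor lies only in the closure, so its orthogonality to the drift
      comes from approximation instead of a computation on fibres.\<close>
    moreover have "(LINT t|mu r. d t * (q t \<bullet> c)) = 0"
    proof -
      have "(LINT t|mu r. (d t *\<^sub>R c) \<bullet> q t) = 0"
        unfolding d_def
      proof (rule orthogonal_periodic_closure[OF r T drift_L2[OF r T] _ q])
        fix p :: "real \<Rightarrow> real ^ 'n" assume p: "p \<in> periodic_cont T"
        then have "(LINT t|mu r. drift r T t * (p t \<bullet> c)) = 0"
          by (intro drift_orthogonal_inner[OF r T] periodic_cont_L2[OF r T]) (auto simp: periodic_cont_def)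
        then show "(LINT t|mu r. (drift r T t *\<^sub>R c) \<bullet> p t) = 0" by (simp add: inner_commute)
      qed
      then show ?thesis by (simp add: inner_commute)
    qed
    moreover have "(LINT t|mu r. d t * (t * (c \<bullet> c))) = H * (c \<bullet> c)"
      unfolding d_def H_def by (rule integral_drift_time[OF r T])
    moreover have "integrable (mu r) (\<lambda>t. d t * (t * (c \<bullet> c)))"
      using integrable_drift_inner[OF r T time_L2[OF r, of c], of c] by (simp add: d_def)
    ultimately have "H * (c \<bullet> c) = 0"
      using integrable_drift_inner[OF r T phL, of c] integrable_drift_inner[OF r T qL, of c]
      by (simp add: d_def)
    then have c: "b = \<alpha>" using Hpos by (simp add: c_def)
    have "AE t in mu r. q t = ph t" using D0 by eventually_elim (simp add: D_def c)
    with c show ?thesis by simp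
  qed
  have "AE t in mu r. p t = periodic_ext T (avg r T x) t - periodic_ext T (avg r T (\<lambda>u. u *\<^sub>R a)) t"
    if "is_solution r T x p a" for p a
    using uniq[OF that] by (simp add: ph_def Px_def d_def periodic_ext_avg_linear[OF r T])
  moreover have "a = (r / T) *\<^sub>R I" if "is_solution r T x p a" for p a
    using uniq[OF that] by (simp add: \<alpha>_def)
  ultimately show ?thesis
    using sol uniq AE_summable[OF r T x] integral_drift(1)[OF r T x] unfolding I_def by blast
qed

end
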